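(* Let $M\ge3$ be an integer, $\mathit{Kn}>0$ and $\Pr>0$. Suppose that differentiable functions $\bar\theta(\bar y)$, $\bar f_\alpha(\bar y)$ form a solution of the $M$-th order stationary one-dimensional linearized moment system of the temperature jump problem, as described in the context. Then $\bar\theta$, $\bar q_2=3\bar t_1+\bar g_1$ and $\hat w$ satisfy the following $2(M-1)$ equations: $$\frac{d\bar q_2}{d\bar y}=0,\qquad \frac{d\bar\theta}{d\bar y}=-\frac25\frac{1}{\mathit{Kn}}\Pr\,\bar q_2-\frac45\frac{d}{d\bar y}\Big(\bar t_0+(1-\delta_{M,3})(6\bar t_2+\bar g_2)\Big),$$ $$\begin{bmatrix}0&M_0 \\ M_0^T&0\end{bmatrix}\frac{d}{d\bar y}\begin{bmatrix}\hat w_{\rm even} \\ \hat w_{\rm odd}\end{bmatrix}=-\frac1{\mathit{Kn}}\begin{bmatrix}\hat w_{\rm even} \\ \hat w_{\rm odd}\end{bmatrix},$$ where $\hat w_{\rm even}=L_1\hat f_{\rm even}$, $\hat w_{\rm odd}=L_2\hat f_{\rm odd}$, and $\hat f_{\rm even},\hat f_{\rm odd},L_1,L_2,M_0$ are defined in the context.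
   Context: Linearized moment system. $e_1,e_2,e_3$ is the standard basis of $\mathbb{R}^3$; $\delta$ is the Kronecker symbol, and $\delta_{|\alpha|\ge2}$ is $1$ if $|\alpha|\ge 2$ and $0$ otherwise. The unknowns are functions of the single variable $\bar y=\bar x_2$: $\bar f_\alpha$ for $\alpha\in\mathbb{N}^3$, $|\alpha|=\alpha_1+\alpha_2+\alpha_3\le M$, the temperature $\bar\theta$ and velocities $\bar u_1,\bar u_2,\bar u_3$, subject to $\bar f_{e_i}=0$, $\sum_{d=1}^3\bar f_{2e_d}=0$, $\bar u_2=0$. The heat flux is $\bar q_i=2\bar f_{3e_i}+\sum_{d=1}^3\bar f_{e_i+2e_d}$. Put $$\bar h_\alpha=\bar f_\alpha+\sum_{k=1}^3\delta_{\alpha,e_k}\bar u_k+\frac12\sum_{k=1}^3\delta_{\alpha,2e_k}\bar\theta,\qquad \bar Q_\alpha=\delta_{|\alpha|\ge2}\bar f_\alpha-\frac{1-\Pr}{5}\sum_{i,j=1}^3\delta_{\alpha,e_i+2e_j}\bar q_i,$$ with $\bar h_\alpha=0$ if $\alpha$ has a negative component. The system (no dependence on time or on $\bar x_1,\bar x_3$) is, for all $|\alpha|\le M$, $$\frac{d\bar h_{\alpha-e_2}}{d\bar y}+(1-\delta_{|\alpha|,M})(\alpha_2+1)\frac{d\bar h_{\alpha+e_2}}{d\bar y}=-\frac{1}{\mathit{Kn}}\bar Q_\alpha .$$ Reduced unknowns: $\bar g_i=\bar f_{2e_1+ie_2}+\bar f_{2e_3+ie_2}$, $\bar t_i=\bar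 f_{(i+2)e_2}$. With $m_o=2\lfloor\frac{M-1}2\rfloor-1$, $m_e=2\lfloor\frac M2\rfloor-1$ (so $m_o+m_e=2(M-2)$), $$\hat f_{\rm even}=(\bar t_0,\bar t_2,\bar g_2,\dots,\bar t_{m_e-1},\bar g_{m_e-1})^T\in\mathbb{R}^{m_e},\qquad \hat f_{\rm odd}=(\bar t_1-\tfrac{\bar q_2}{5},\bar t_3,\bar g_3,\dots,\bar t_{m_o},\bar g_{m_o})^T\in\mathbb{R}^{m_o}.$$ For $M=3$ the term with factor $(1-\delta_{M,3})$ is absent. Matrices. $\mathrm{He}_n$ is the probabilists' Hermite polynomial, $\mathrm{He}_\alpha(\xi)=\prod_i\mathrm{He}_{\alpha_i}(\xi_i)$, $\bar\omega(\xi)=(2\pi)^{-3/2}e^{-|\xi|^2/2}$, $\langle p,q\rangle_{\bar\omega}=\int_{\mathbb{R}^3}pq\,\bar\omega\,d\xi$. $\phi_1=\mathrm{He}_{2e_2}-\frac12(\mathrm{He}_{2e_1}+\mathrm{He}_{2e_3})$, $\phi_{2k}=\mathrm{He}_{(2k+2)e_2}$, $\phi_{2k+1}=\frac12(\mathrm{He}_{2e_1+2ke_2}+\mathrm{He}_{2e_3+2ke_2})$ for $1\le k\le(m_e-1)/2$; $\varphi_1=\mathrm{He}_{3e_2}-\frac32(\mathrm{He}_{2e_1+e_2}+\mathrm{He}_{2e_3+e_2})$, $\varphi_{2k}=\mathrm{He}_{(2k+3)e_2}$, $\varphi_{2k+1}=\frac12(\mathrm{He}_{2e_1+(2k+1)e_2}+\mathrm{He}_{2e_3+(2k+1)e_2})$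 for $1\le k\le(m_o-1)/2$. $a_i=\sqrt{\langle\phi_i,\phi_i\rangle_{\bar\omega}}$, $b_j=\sqrt{\langle\varphi_j,\varphi_j\rangle_{\bar\omega}}$, $L_1=\mathrm{diag}(a_i)_{i=1}^{m_e}$, $L_2=\mathrm{diag}(b_j)_{j=1}^{m_o}$, $M_0=(m^0_{ij})\in\mathbb{R}^{m_e\times m_o}$, $m^0_{ij}=\frac1{a_ib_j}\langle\phi_i,\xi_2\varphi_j\rangle_{\bar\omega}$. *)

theory Defs
  imports "Jordan_Normal_Form.Matrix" "HOL-Analysis.Analysis"
begin

(* Both libraries use the infix dollar; it is kept for the fixed-dimension vectors of
   HOL-Analysis (velocities real^3, multi-indices nat^3).  Vectors and matrices whose size depends
   on M are those of Jordan_Normal_Form and are accessed with vec_index. *)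
no_notation vec_index (infixl "$" 100)

section \<open>The linearized moment system\<close>

definition \<ee> :: "3 \<Rightarrow> nat^3" where
  "\<ee> i = axis i 1"

definition mlen :: "nat^3 \<Rightarrow> nat" where
  "mlen \<alpha> = (\<Sum>i\<in>UNIV. \<alpha> $ i)"

text \<open>The unknowns live on a set \<open>S\<close> of values of the space variable; the derivative is
  the one within \<open>S\<close>, hence one-sided at an end point belonging to \<open>S\<close>.\<close>

definition ddy :: "real set \<Rightarrow> (real \<Rightarrow> real) \<Rightarrow> real \<Rightarrow> real" where
  "ddy S g y = vector_derivative g (at y within S)"

definition qbar :: "(nat^3 \<Rightarrow> real \<Rightarrow> real) \<Rightarrow> 3 \<Rightarrow> real \<Rightarrow> real" where
  "qbar f i y = 2 * f (3 *s \<ee> i) y + (\<Sum>d\<in>UNIV. f (\<ee> i + 2 *s \<ee> d) y)"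

definition hbar :: "(nat^3 \<Rightarrow> real \<Rightarrow> real) \<Rightarrow> (real \<Rightarrow> real) \<Rightarrow> (3 \<Rightarrow> real \<Rightarrow> real)
    \<Rightarrow> nat^3 \<Rightarrow> real \<Rightarrow> real" where
  "hbar f \<theta> u \<alpha> y = f \<alpha> y + (\<Sum>k\<in>UNIV. of_bool (\<alpha> = \<ee> k) * u k y)
     + 1/2 * (\<Sum>k\<in>UNIV. of_bool (\<alpha> = 2 *s \<ee> k) * \<theta> y)"

text \<open>\<open>hbar\<close> at the index \<open>\<alpha> - e\<^sub>2\<close>, which is \<open>0\<close> if that index has a negative component.
  The case distinction is needed because subtraction on \<^typ>\<open>nat^3\<close> truncates.\<close>

definition hbar_pred :: "(nat^3 \<Rightarrow> real \<Rightarrow> real) \<Rightarrow> (real \<Rightarrow> real) \<Rightarrow> (3 \<Rightarrow> real \<Rightarrow> real)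
    \<Rightarrow> nat^3 \<Rightarrow> real \<Rightarrow> real" where
  "hbar_pred f \<theta> u \<alpha> y = (if \<alpha> $ 2 = 0 then 0 else hbar f \<theta> u (\<alpha> - \<ee> 2) y)"

definition Qbar :: "real \<Rightarrow> (nat^3 \<Rightarrow> real \<Rightarrow> real) \<Rightarrow> nat^3 \<Rightarrow> real \<Rightarrow> real" where
  "Qbar Pr f \<alpha> y = of_bool (mlen \<alpha> \<ge> 2) * f \<alpha> y
     - (1 - Pr) / 5 * (\<Sum>i\<in>UNIV. \<Sum>j\<in>UNIV. of_bool (\<alpha> = \<ee> i + 2 *s \<ee> j) * qbar f i y)"

text \<open>Only the moments \<open>f \<alpha>\<close> with \<open>mlen \<alpha> \<le> M\<close> are unknowns of the system; the values of \<open>f\<close> at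
  longer multi-indices are irrelevant (for \<open>mlen \<alpha> = M\<close> the second term below has factor \<open>0\<close>).\<close>

definition moment_solution :: "nat \<Rightarrow> real \<Rightarrow> real \<Rightarrow> real set \<Rightarrow> (nat^3 \<Rightarrow> real \<Rightarrow> real)
    \<Rightarrow> (real \<Rightarrow> real) \<Rightarrow> (3 \<Rightarrow> real \<Rightarrow> real) \<Rightarrow> bool" where
  "moment_solution M Kn Pr S f \<theta> u \<longleftrightarrow>
     (\<forall>\<alpha>. mlen \<alpha> \<le> M \<longrightarrow> f \<alpha> differentiable_on S) \<and>
     \<theta> differentiable_on S \<and>
     (\<forall>k. u k differentiable_on S) \<and>
     (\<forall>y\<in>S. (\<forall>i. f (\<ee> i) y = 0) \<and> (\<Sum>d\<in>UNIV. f (2 *s \<ee> d) y) = 0 \<and> u 2 y = 0) \<and>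
     (\<forall>y\<in>S. \<forall>\<alpha>. mlen \<alpha> \<le> M \<longrightarrow>
        ddy S (hbar_pred f \<theta> u \<alpha>) y
        + (1 - of_bool (mlen \<alpha> = M)) * real (\<alpha> $ 2 + 1) * ddy S (hbar f \<theta> u (\<alpha> + \<ee> 2)) y
        = - (1 / Kn) * Qbar Pr f \<alpha> y)"


section \<open>Reduced unknowns\<close>

definition gbar :: "(nat^3 \<Rightarrow> real \<Rightarrow> real) \<Rightarrow> nat \<Rightarrow> real \<Rightarrow> real" where
  "gbar f i y = f (2 *s \<ee> 1 + i *s \<ee> 2) y + f (2 *s \<ee> 3 + i *s \<ee> 2) y"

definition tbar :: "(nat^3 \<Rightarrow> real \<Rightarrow> real) \<Rightarrow> nat \<Rightarrow> real \<Rightarrow> real" where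
  "tbar f i y = f ((i + 2) *s \<ee> 2) y"

definition m_odd :: "nat \<Rightarrow> nat" where
  "m_odd M = 2 * ((M - 1) div 2) - 1"

definition m_even :: "nat \<Rightarrow> nat" where
  "m_even M = 2 * (M div 2) - 1"

text \<open>The entries are listed with the index \<open>n\<close> starting at \<open>1\<close>, as in the mathematical notation:
  entry \<open>2k\<close> is a \<open>tbar\<close> and entry \<open>2k + 1\<close> is a \<open>gbar\<close>.  Since vectors and matrices of
  \<^typ>\<open>'a Matrix.vec\<close> and \<^typ>\<open>'a Matrix.mat\<close> are indexed from \<open>0\<close>, they are built with \<open>Suc i\<close>.\<close>

definition f_even_entry :: "(nat^3 \<Rightarrow> real \<Rightarrow> real) \<Rightarrow> nat \<Rightarrow> real \<Rightarrow> real" where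
  "f_even_entry f n y =
     (if n = 1 then tbar f 0 y else if even n then tbar f n y else gbar f (n - 1) y)"

definition f_odd_entry :: "(nat^3 \<Rightarrow> real \<Rightarrow> real) \<Rightarrow> nat \<Rightarrow> real \<Rightarrow> real" where
  "f_odd_entry f n y =
     (if n = 1 then tbar f 1 y - qbar f 2 y / 5
      else if even n then tbar f (n + 1) y else gbar f n y)"

definition f_even :: "nat \<Rightarrow> (nat^3 \<Rightarrow> real \<Rightarrow> real) \<Rightarrow> real \<Rightarrow> real Matrix.vec" where
  "f_even M f y = Matrix.vec (m_even M) (\<lambda>i. f_even_entry f (Suc i) y)"

definition f_odd :: "nat \<Rightarrow> (nat^3 \<Rightarrow> real \<Rightarrow> real) \<Rightarrow> real \<Rightarrow> real Matrix.vec" where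
  "f_odd M f y = Matrix.vec (m_odd M) (\<lambda>i. f_odd_entry f (Suc i) y)"


section \<open>Hermite polynomials and the coefficient matrices\<close>

text \<open>Probabilists' Hermite polynomials, by the three-term recurrence
  \<open>He\<^bsub>n+1\<^esub>(x) = x He\<^bsub>n\<^esub>(x) - n He\<^bsub>n-1\<^esub>(x)\<close>.\<close>

fun He1 :: "nat \<Rightarrow> real \<Rightarrow> real" where
  "He1 0 x = 1"
| "He1 (Suc 0) x = x"
| "He1 (Suc (Suc n)) x = x * He1 (Suc n) x - real (Suc n) * He1 n x"

definition He :: "nat^3 \<Rightarrow> real^3 \<Rightarrow> real" where
  "He \<alpha> \<xi> = (\<Prod>i\<in>UNIV. He1 (\<alpha> $ i) (\<xi> $ i))"

definition \<omega> :: "real^3 \<Rightarrow> real" where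
  "\<omega> \<xi> = (2 * pi) powr (- 3 / 2) * exp (- (norm \<xi>)\<^sup>2 / 2)"

definition ip_\<omega> :: "(real^3 \<Rightarrow> real) \<Rightarrow> (real^3 \<Rightarrow> real) \<Rightarrow> real" where
  "ip_\<omega> p q = (\<integral>\<xi>. p \<xi> * q \<xi> * \<omega> \<xi> \<partial>lborel)"

definition phi :: "nat \<Rightarrow> real^3 \<Rightarrow> real" where
  "phi n \<xi> =
     (if n = 1 then He (2 *s \<ee> 2) \<xi> - 1/2 * (He (2 *s \<ee> 1) \<xi> + He (2 *s \<ee> 3) \<xi>)
      else if even n then He ((n + 2) *s \<ee> 2) \<xi>
      else 1/2 * (He (2 *s \<ee> 1 + (n - 1) *s \<ee> 2) \<xi> + He (2 *s \<ee> 3 + (n - 1) *s \<ee> 2) \<xi>))"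

definition varphi :: "nat \<Rightarrow> real^3 \<Rightarrow> real" where
  "varphi n \<xi> =
     (if n = 1 then He (3 *s \<ee> 2) \<xi> - 3/2 * (He (2 *s \<ee> 1 + \<ee> 2) \<xi> + He (2 *s \<ee> 3 + \<ee> 2) \<xi>)
      else if even n then He ((n + 3) *s \<ee> 2) \<xi>
      else 1/2 * (He (2 *s \<ee> 1 + n *s \<ee> 2) \<xi> + He (2 *s \<ee> 3 + n *s \<ee> 2) \<xi>))"

definition a_coef :: "nat \<Rightarrow> real" where
  "a_coef i = sqrt (ip_\<omega> (phi i) (phi i))"

definition b_coef :: "nat \<Rightarrow> real" where
  "b_coef j = sqrt (ip_\<omega> (varphi j) (varphi j))"

definition L1 :: "nat \<Rightarrow> real Matrix.mat" where
  "L1 M = mat_diag (m_even M) (\<lambda>i. a_coef (Suc i))"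

definition L2 :: "nat \<Rightarrow> real Matrix.mat" where
  "L2 M = mat_diag (m_odd M) (\<lambda>j. b_coef (Suc j))"

definition m0_entry :: "nat \<Rightarrow> nat \<Rightarrow> real" where
  "m0_entry i j = 1 / (a_coef i * b_coef j) * ip_\<omega> (phi i) (\<lambda>\<xi>. \<xi> $ 2 * varphi j \<xi>)"

definition M0 :: "nat \<Rightarrow> real Matrix.mat" where
  "M0 M = Matrix.mat (m_even M) (m_odd M) (\<lambda>(i, j). m0_entry (Suc i) (Suc j))"

definition block_matrix :: "nat \<Rightarrow> real Matrix.mat" where
  "block_matrix M = four_block_mat
     (0\<^sub>m (m_even M) (m_even M)) (M0 M)
     (transpose_mat (M0 M))      (0\<^sub>m (m_odd M) (m_odd M))"

definition w_even :: "nat \<Rightarrow> (nat^3 \<Rightarrow> real \<Rightarrow> real) \<Rightarrow> real \<Rightarrow> real Matrix.vec" where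
  "w_even M f y = L1 M *\<^sub>v f_even M f y"

definition w_odd :: "nat \<Rightarrow> (nat^3 \<Rightarrow> real \<Rightarrow> real) \<Rightarrow> real \<Rightarrow> real Matrix.vec" where
  "w_odd M f y = L2 M *\<^sub>v f_odd M f y"

definition w_hat :: "nat \<Rightarrow> (nat^3 \<Rightarrow> real \<Rightarrow> real) \<Rightarrow> real \<Rightarrow> real Matrix.vec" where
  "w_hat M f y = w_even M f y @\<^sub>v w_odd M f y"

definition ddy_vec :: "real set \<Rightarrow> (real \<Rightarrow> real Matrix.vec) \<Rightarrow> real \<Rightarrow> real Matrix.vec" where
  "ddy_vec S v y = Matrix.vec (dim_vec (v y)) (\<lambda>i. ddy S (\<lambda>z. vec_index (v z) i) y)"

end

(* The rows of the matrix equation are the scalar moment equations for the indices (i+2)e_2 and, summed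
   over k = 1, 3, for 2e_k + i e_2, rescaled by factorials.  By orthogonality of the Hermite
   polynomials and x He_n = He_(n+1) + n He_(n-1), the matrix of the inner products
   <phi_i, xi_2 varphi_j> is sparse, with at most two nonzero entries per row; only the rows of phi_1 and
   varphi_1 and those coupled to varphi_1 mix several moment equations.  The equations for 3e_2 and
   2e_k + e_2 combine in two ways: one combination eliminates theta (the row of varphi_1), the other
   gives the temperature equation.  The equations for 2e_1, 2e_2, 2e_3 with the trace constraint make
   the heat flux constant, so that its multiple in the first odd unknown drops out when
   differentiated. *)
theory Submission
  imports Defs "HOL-Probability.Distributions" "HOL-Computational_Algebra.Polynomial"
begin

section \<open>Hermite polynomials under the Gaussian weight\<close>

text \<open>The polynomials \<open>He1\<close> as elements of \<open>real poly\<close>, so that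
  \<open>pderiv\<close> and the expansion into monomials are available for integration by
  parts.\<close>

fun hermite_poly :: "nat \<Rightarrow> real poly" where
  "hermite_poly 0 = 1"
| "hermite_poly (Suc 0) = [:0, 1:]"
| "hermite_poly (Suc (Suc n)) = [:0, 1:] * hermite_poly (Suc n) - smult (real (Suc n)) (hermite_poly n)"

lemma poly_hermite_poly: "poly (hermite_poly n) x = He1 n x"
  by (induction n rule: hermite_poly.induct) auto

text \<open>Differentiating the recurrence and inserting the two induction hypotheses reproduces the
  recurrence itself one degree lower.\<close>

lemma pderiv_hermite_poly_Suc:
  "pderiv (hermite_poly (Suc n)) = smult (real (Suc n)) (hermite_poly n)"
proof (induction n rule: hermite_poly.induct)
  case (3 n)
  have "pderiv (hermite_poly (Suc (Suc (Suc n)))) =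
      hermite_poly (Suc (Suc n)) + [:0, 1:] * pderiv (hermite_poly (Suc (Suc n)))
        - smult (real (Suc (Suc n))) (pderiv (hermite_poly (Suc n)))"
    by (simp add: pderiv_diff pderiv_mult pderiv_smult pderiv_pCons del: hermite_poly.simps(3)
        add: hermite_poly.simps(3)[of "Suc n"])
  also have "\<dots> = smult (real (Suc (Suc (Suc n)))) (hermite_poly (Suc (Suc n)))"
    unfolding 3 by (rule poly_eqI) (simp add: algebra_simps coeff_pCons split: nat.split)
  finally show ?case .
qed (auto simp: pderiv_pCons pderiv_diff pderiv_1 one_pCons)

section \<open>One-dimensional Gaussian integrals\<close>

definition gauss_int :: "real poly \<Rightarrow> real" where
  "gauss_int p = (\<integral>x. poly p x * std_normal_density x \<partial>lborel)"

lemma integrable_poly_gauss: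
  "integrable lborel (\<lambda>x. poly p x * std_normal_density x)"
proof -
  have "(\<lambda>x. poly p x * std_normal_density x)
      = (\<lambda>x. \<Sum>i\<le>degree p. coeff p i * (std_normal_density x * x ^ i))"
    by (auto simp: poly_altdef sum_distrib_right sum_distrib_left mult_ac intro!: ext sum.cong)
  then show ?thesis
    by (auto intro!: integrable_std_normal_moment)
qed

lemma gauss_int_add: "gauss_int (p + q) = gauss_int p + gauss_int q"
  using integrable_poly_gauss[of p] integrable_poly_gauss[of q]
  by (simp add: gauss_int_def algebra_simps)

lemma gauss_int_smult: "gauss_int (smult c p) = c * gauss_int p"
  by (simp add: gauss_int_def mult.assoc)

lemma gauss_int_diff: "gauss_int (p - q) = gauss_int p - gauss_int q"
  using gauss_int_add[of p "smult (-1) q"] gauss_int_smult[of "-1" q] by simp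

lemma gauss_int_sum: "gauss_int (\<Sum>i\<in>I. p i) = (\<Sum>i\<in>I. gauss_int (p i))"
  by (induction I rule: infinite_finite_induct)
     (auto simp: gauss_int_add gauss_int_def[of 0])

text \<open>Read off from the known moments: the odd ones vanish, and consecutive even ones
  \<open>fact (2 * k) / (2 ^ k * fact k)\<close> have quotient \<open>2 * k + 1\<close>.\<close>

lemma gauss_int_monom_Suc:
  "gauss_int (monom c (Suc n)) = gauss_int (pderiv (monom c n))"
proof -
  have even_case: "gauss_int (monom 1 (2 * k)) = fact (2 * k) / (2 ^ k * fact k)" for k
    using integral_std_normal_moment_even[of k]
    by (simp add: gauss_int_def poly_monom mult.commute)
  have odd_case: "gauss_int (monom 1 (2 * k + 1)) = 0" for k
    using integral_std_normal_moment_odd[of k]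
    by (simp add: gauss_int_def poly_monom mult.commute)
  \<comment> \<open>At \<open>n = 0\<close> the truncated exponent \<open>n - 1\<close> is harmless,
    since its factor is 0.\<close>
  have "gauss_int (monom 1 (Suc n)) = real n * gauss_int (monom 1 (n - 1))"
  proof (cases "even n")
    case True
    then obtain k where k: "n = 2 * k" by auto
    show ?thesis
    proof (cases k)
      case 0
      then show ?thesis using k odd_case[of 0] by simp
    next
      case (Suc l)
      then have "n - 1 = 2 * l + 1" using k by simp
      then show ?thesis using odd_case[of k] odd_case[of l] k by simp
    qed
  next
    case False
    then obtain k where k: "n = 2 * k + 1" by (auto elim: oddE)
    have "gauss_int (monom 1 (2 * Suc k)) = real (2 * k + 1) * gauss_int (monom 1 (2 * k))"
    proof -
      have "fact (2 * Suc k) = (2 * real (Suc k)) * (real (2 * k + 1) * fact (2 * k))"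
        by (simp add: algebra_simps)
      moreover have "2 ^ Suc k * fact (Suc k) = (2 * real (Suc k)) * (2 ^ k * fact k)"
        by simp
      ultimately show ?thesis
        unfolding even_case by (simp only: mult_divide_mult_cancel_left_if) simp
    qed
    then show ?thesis using k by simp
  qed
  moreover have "monom c m = smult c (monom 1 m)" for m by (simp add: smult_monom)
  moreover have "pderiv (monom c n) = smult (c * real n) (monom 1 (n - 1))"
    by (simp add: pderiv_monom smult_monom mult.commute)
  ultimately show ?thesis by (metis gauss_int_smult mult.assoc)
qed

text \<open>Gaussian integration by parts.\<close>

lemma gauss_int_pCons_0: "gauss_int (pCons 0 p) = gauss_int (pderiv p)"
proof -
  \<comment> \<open>Both sides are linear in \<open>p\<close>, so the monomial case
    suffices.\<close>
  have p: "p = (\<Sum>i\<le>degree p. monom (coeff p i) i)"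
    by (simp add: poly_as_sum_of_monoms)
  have "gauss_int (pCons 0 p) = (\<Sum>i\<le>degree p. gauss_int (monom (coeff p i) (Suc i)))"
  proof -
    have "pCons 0 p = (\<Sum>i\<le>degree p. monom (coeff p i) (Suc i))"
      using arg_cong[OF p, of "\<lambda>q. monom 1 1 * q"]
      by (simp add: sum_distrib_left mult_monom monom_altdef)
    then show ?thesis by (metis gauss_int_sum)
  qed
  also have "\<dots> = gauss_int (pderiv p)"
  proof -
    have "pderiv p = (\<Sum>i\<le>degree p. pderiv (monom (coeff p i) i))"
      using arg_cong[OF p, of pderiv] by (simp add: higher_pderiv_sum[where n = 1, simplified])
    then show ?thesis by (simp only: gauss_int_sum gauss_int_monom_Suc)
  qed
  finally show ?thesis .
qed

text \<open>The next Hermite polynomial is \<open>x\<close> times the current one minus its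
  derivative. Integration by parts differentiates the whole product; the subtracted term cancels one
  half of the product rule, and the derivative of \<open>hermite_poly n\<close> remains.\<close>

lemma gauss_int_hermite_Suc:
  "gauss_int (hermite_poly (Suc m) * hermite_poly n)
    = real n * gauss_int (hermite_poly m * hermite_poly (n - 1))"
proof -
  have *: "pderiv (hermite_poly n) = smult (real n) (hermite_poly (n - 1))" for n
    by (cases n) (auto simp: pderiv_hermite_poly_Suc pderiv_1 simp del: hermite_poly.simps(2-))
  have "hermite_poly (Suc m) = pCons 0 (hermite_poly m) - pderiv (hermite_poly m)"
    by (cases m) (auto simp: pderiv_hermite_poly_Suc pderiv_1 one_pCons)
  then have "gauss_int (hermite_poly (Suc m) * hermite_poly n)
      = gauss_int (pCons 0 (hermite_poly m * hermite_poly n))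
        - gauss_int (pderiv (hermite_poly m) * hermite_poly n)"
    by (simp add: left_diff_distrib gauss_int_diff)
  then show ?thesis
    by (simp add: gauss_int_pCons_0 pderiv_mult gauss_int_add * gauss_int_smult mult.commute)
qed

text \<open>The lowering identity reduces both degrees at once: unequal degrees eventually meet a
  factor 0, equal ones collect the factorial.\<close>

lemma gauss_int_hermite: "gauss_int (hermite_poly m * hermite_poly n) = of_bool (m = n) * fact n"
proof (induction m arbitrary: n)
  case 0
  show ?case
  proof (cases n)
    case 0
    then show ?thesis
      using integral_std_normal_moment_even[of 0] by (simp add: gauss_int_def)
  next
    case (Suc k)
    \<comment> \<open>With the two polynomials exchanged, the lowering identity carries the factor
      \<open>real 0\<close>.\<close>
    then show ?thesis
      using gauss_int_hermite_Suc[of k 0] by (simp add: mult.commute)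
  qed
next
  case (Suc m)
  then show ?case
    by (cases n) (auto simp: gauss_int_hermite_Suc simp del: hermite_poly.simps)
qed

text \<open>Fubini for products of one-variable functions. \<open>lborel_eq\<close> presents
  Lebesgue measure as the image of a product measure indexed by \<open>Basis\<close>, so products
  over coordinates are reindexed along \<open>axis i 1\<close>.\<close>

lemma
  fixes p :: "'n::finite \<Rightarrow> real \<Rightarrow> real"
  assumes p: "\<And>i. integrable lborel (p i)"
  shows integrable_prod_vec: "integrable lborel (\<lambda>x::real^'n. \<Prod>i\<in>UNIV. p i (x $ i))"
    and integral_prod_vec: "integral\<^sup>L lborel (\<lambda>x::real^'n. \<Prod>i\<in>UNIV. p i (x $ i))
        = (\<Prod>i\<in>UNIV. integral\<^sup>L lborel (p i))"
proof -
  interpret product_sigma_finite "\<lambda>_::real^'n. lborel :: real measure"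
    by standard
  \<comment> \<open>Inverse of the enumeration of the basis vectors by coordinates.\<close>
  define ix :: "real^'n \<Rightarrow> 'n" where "ix = (\<lambda>b. THE i. b = axis i 1)"
  have ix: "ix (axis i 1) = i" for i
    unfolding ix_def by (rule the_equality) (auto simp: axis_eq_axis)
  have inj: "inj (\<lambda>i::'n. axis i (1::real))"
    by (auto simp: inj_on_def axis_eq_axis)
  have Basis: "(Basis :: (real^'n) set) = range (\<lambda>i. axis i 1)"
    by (auto simp: Basis_vec_def)
  have prod: "(\<Prod>b\<in>Basis. g b) = (\<Prod>i\<in>UNIV. g (axis i 1))" for g :: "real^'n \<Rightarrow> real"
    by (simp add: Basis prod.reindex[OF inj])
  have coord: "(\<Sum>b\<in>Basis. x b *\<^sub>R b) $ i = x (axis i 1)" for x :: "real^'n \<Rightarrow> real" and i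
  proof -
    have "(\<Sum>b\<in>Basis. x b *\<^sub>R b) $ i = (\<Sum>j\<in>UNIV. x (axis j 1) * axis j 1 $ i)"
      by (simp add: Basis sum.reindex[OF inj])
    also have "\<dots> = (\<Sum>j\<in>UNIV. if j = i then x (axis j 1) else 0)"
      by (intro sum.cong) (auto simp: axis_def)
    finally show ?thesis by simp
  qed
  have "(\<lambda>x. \<Prod>b\<in>Basis. p (ix b) (x b)) = (\<lambda>x. \<Prod>i\<in>UNIV. p i ((\<Sum>b\<in>Basis. x b *\<^sub>R b) $ i))"
    unfolding prod ix coord ..
  note eq = this
  have m: "(\<lambda>x::real^'n. \<Prod>i\<in>UNIV. p i (x $ i)) \<in> borel_measurable borel"
    using borel_measurable_integrable[OF p] by measurable
  have "integrable (\<Pi>\<^sub>M b\<in>Basis. lborel) (\<lambda>x. \<Prod>b\<in>Basis. p (ix b) (x b))"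
    by (rule product_integrable_prod) (auto intro: p)
  then show "integrable lborel (\<lambda>x::real^'n. \<Prod>i\<in>UNIV. p i (x $ i))"
    using m by (subst lborel_eq) (simp add: integrable_distr_eq eq)
  have "(\<integral>x. (\<Prod>b\<in>Basis. p (ix b) (x b)) \<partial>(\<Pi>\<^sub>M b\<in>Basis. lborel)) =
      (\<Prod>i\<in>UNIV. integral\<^sup>L lborel (p i))"
    by (subst product_integral_prod) (auto intro: p simp: prod ix)
  then show "integral\<^sup>L lborel (\<lambda>x::real^'n. \<Prod>i\<in>UNIV. p i (x $ i))
        = (\<Prod>i\<in>UNIV. integral\<^sup>L lborel (p i))"
    using m by (subst lborel_eq) (simp add: integral_distr eq)
qed

lemma \<omega>_eq_prod: "\<omega> \<xi> = (\<Prod>i\<in>UNIV. std_normal_density (\<xi> $ i))"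
proof -
  have "(2 * pi) powr (- 3 / 2) = (1 / sqrt (2 * pi)) ^ 3"
  proof -
    have "(1 / sqrt (2 * pi)) ^ 3 = ((2 * pi) powr (- 1 / 2)) powr 3"
      by (simp add: powr_minus powr_half_sqrt field_simps powr_realpow[of "(2 * pi) powr (- 1 / 2)" 3, simplified])
    then show ?thesis by (simp add: powr_powr)
  qed
  moreover have "exp (- (norm \<xi>)\<^sup>2 / 2) = (\<Prod>i\<in>UNIV. exp (- (\<xi> $ i)\<^sup>2 / 2))"
  proof -
    have "(norm \<xi>)\<^sup>2 = (\<Sum>i\<in>UNIV. (\<xi> $ i)\<^sup>2)"
      by (simp only: power2_norm_eq_inner inner_vec_def) (simp add: power2_eq_square)
    then show ?thesis
      by (simp add: exp_sum[symmetric] sum_divide_distrib sum_negf)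
  qed
  ultimately show ?thesis
    by (simp add: \<omega>_def std_normal_density_def prod_dividef power_divide)
qed

text \<open>Both \<open>He\<close> and \<open>\<omega>\<close> factor over the coordinates, so one
  differing index makes the product of one-dimensional integrals vanish.\<close>

lemma
  shows integrable_He_He: "integrable lborel (\<lambda>\<xi>. He \<alpha> \<xi> * He \<beta> \<xi> * \<omega> \<xi>)"
    and ip_He_He: "ip_\<omega> (He \<alpha>) (He \<beta>) = of_bool (\<alpha> = \<beta>) * (\<Prod>i\<in>UNIV. fact (\<alpha> $ i))"
proof -
  let ?p = "\<lambda>i x. poly (hermite_poly (\<alpha> $ i) * hermite_poly (\<beta> $ i)) x * std_normal_density x"
  have eq: "(\<lambda>\<xi>. He \<alpha> \<xi> * He \<beta> \<xi> * \<omega> \<xi>) = (\<lambda>\<xi>. \<Prod>i\<in>UNIV. ?p i (\<xi> $ i))"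
    by (simp add: He_def \<omega>_eq_prod prod.distrib poly_hermite_poly)
  show "integrable lborel (\<lambda>\<xi>. He \<alpha> \<xi> * He \<beta> \<xi> * \<omega> \<xi>)"
    unfolding eq by (intro integrable_prod_vec integrable_poly_gauss)
  have "ip_\<omega> (He \<alpha>) (He \<beta>) = (\<Prod>i\<in>UNIV. gauss_int (hermite_poly (\<alpha> $ i) * hermite_poly (\<beta> $ i)))"
    unfolding ip_\<omega>_def eq gauss_int_def
    by (intro integral_prod_vec integrable_poly_gauss)
  also have "\<dots> = of_bool (\<alpha> = \<beta>) * (\<Prod>i\<in>UNIV. fact (\<alpha> $ i))"
    by (auto simp: gauss_int_hermite vec_eq_iff)
  finally show "ip_\<omega> (He \<alpha>) (He \<beta>) = of_bool (\<alpha> = \<beta>) * (\<Prod>i\<in>UNIV. fact (\<alpha> $ i))" .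
qed

section \<open>The coupling coefficients\<close>

lemma ip_commute: "ip_\<omega> p q = ip_\<omega> q p"
  by (simp add: ip_\<omega>_def mult.commute)

text \<open>Additivity of the integral requires integrability, which is therefore passed along so
  that the rule can be iterated.\<close>

lemma
  assumes "integrable lborel (\<lambda>\<xi>. p \<xi> * s \<xi> * \<omega> \<xi>)" "integrable lborel (\<lambda>\<xi>. q \<xi> * s \<xi> * \<omega> \<xi>)"
  shows integrable_lincomb: "integrable lborel (\<lambda>\<xi>. (a * p \<xi> + b * q \<xi>) * s \<xi> * \<omega> \<xi>)"
    and ip_lincomb: "ip_\<omega> (\<lambda>\<xi>. a * p \<xi> + b * q \<xi>) s = a * ip_\<omega> p s + b * ip_\<omega> q s"
proof -
  have eq: "(a * p \<xi> + b * q \<xi>) * s \<xi> * \<omega> \<xi>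
      = a * (p \<xi> * s \<xi> * \<omega> \<xi>) + b * (q \<xi> * s \<xi> * \<omega> \<xi>)" for \<xi>
    by (simp add: algebra_simps)
  show "integrable lborel (\<lambda>\<xi>. (a * p \<xi> + b * q \<xi>) * s \<xi> * \<omega> \<xi>)"
    unfolding eq using assms by simp
  show "ip_\<omega> (\<lambda>\<xi>. a * p \<xi> + b * q \<xi>) s = a * ip_\<omega> p s + b * ip_\<omega> q s"
    unfolding ip_\<omega>_def eq using assms by simp
qed

lemma one_smult [simp]: "1 *s \<alpha> = \<alpha>" "Suc 0 *s \<alpha> = \<alpha>" for \<alpha> :: "nat^3"
  by (simp_all add: vec_eq_iff)

text \<open>Every \<open>phi n\<close> and \<open>varphi n\<close> has this shape, and multiplication by \<open>\<xi>\<^sub>2\<close> preserves it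
  up to sums.\<close>

definition axial :: "real \<Rightarrow> real \<Rightarrow> nat \<Rightarrow> nat \<Rightarrow> real^3 \<Rightarrow> real" where
  "axial a b i j \<xi> = a * He (i *s \<ee> 2) \<xi>
     + b * (He (2 *s \<ee> 1 + j *s \<ee> 2) \<xi> + He (2 *s \<ee> 3 + j *s \<ee> 2) \<xi>)"

lemma prod_UNIV_3: "prod g UNIV = g 1 * g 2 * g 3" for g :: "3 \<Rightarrow> 'a::comm_monoid_mult"
  unfolding UNIV_3 by (simp add: mult.assoc)

lemma ee_component: "\<ee> 1 $ 1 = 1" "\<ee> 1 $ 2 = 0" "\<ee> 1 $ 3 = 0" "\<ee> 2 $ 1 = 0" "\<ee> 2 $ 2 = 1"
  "\<ee> 2 $ 3 = 0" "\<ee> 3 $ 1 = 0" "\<ee> 3 $ 2 = 0" "\<ee> 3 $ 3 = 1"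
  by (simp_all add: \<ee>_def axis_def)

lemma axial_index_eq:
  "i *s \<ee> 2 = i' *s \<ee> 2 \<longleftrightarrow> i = i'"
  "i *s \<ee> 2 = 2 *s \<ee> 1 + j *s \<ee> 2 \<longleftrightarrow> False" "2 *s \<ee> 1 + j *s \<ee> 2 = i *s \<ee> 2 \<longleftrightarrow> False"
  "i *s \<ee> 2 = 2 *s \<ee> 3 + j *s \<ee> 2 \<longleftrightarrow> False" "2 *s \<ee> 3 + j *s \<ee> 2 = i *s \<ee> 2 \<longleftrightarrow> False"
  "2 *s \<ee> 1 + j *s \<ee> 2 = 2 *s \<ee> 3 + j' *s \<ee> 2 \<longleftrightarrow> False"
  "2 *s \<ee> 3 + j *s \<ee> 2 = 2 *s \<ee> 1 + j' *s \<ee> 2 \<longleftrightarrow> False"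
  "2 *s \<ee> 1 + j *s \<ee> 2 = 2 *s \<ee> 1 + j' *s \<ee> 2 \<longleftrightarrow> j = j'"
  "2 *s \<ee> 3 + j *s \<ee> 2 = 2 *s \<ee> 3 + j' *s \<ee> 2 \<longleftrightarrow> j = j'"
  unfolding vec_eq_iff forall_3 vector_add_component vector_smult_component ee_component
  by simp_all

lemma axial_He1: "axial a b i j \<xi>
    = a * He1 i (\<xi> $ 2) + b * (He1 2 (\<xi> $ 1) + He1 2 (\<xi> $ 3)) * He1 j (\<xi> $ 2)"
  unfolding axial_def He_def prod_UNIV_3 vector_add_component vector_smult_component ee_component
  by (simp add: distrib_left distrib_right mult_ac)

text \<open>The factors \<open>1\<close> make the right-hand side an instance of the linear combination in
  \<open>ip_lincomb\<close>.\<close>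

lemma xi2_mult_axial: "\<xi> $ 2 * axial a b i j \<xi>
    = 1 * axial a b (Suc i) (Suc j) \<xi> + 1 * axial (a * i) (b * j) (i - 1) (j - 1) \<xi>"
proof -
  \<comment> \<open>The recurrence solved for the product with \<open>x\<close>. At
    \<open>n = 0\<close> the truncated index carries the coefficient 0, as do \<open>i - 1\<close>
    and \<open>j - 1\<close> in the claim.\<close>
  have *: "x * He1 n x = He1 (Suc n) x + real n * He1 (n - 1) x" for n x
    by (cases n) auto
  have "\<xi> $ 2 * axial a b i j \<xi> = a * (\<xi> $ 2 * He1 i (\<xi> $ 2))
      + b * (He1 2 (\<xi> $ 1) + He1 2 (\<xi> $ 3)) * (\<xi> $ 2 * He1 j (\<xi> $ 2))"
    by (simp add: axial_He1 distrib_left mult_ac)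
  also have "\<dots> = 1 * axial a b (Suc i) (Suc j) \<xi> + 1 * axial (a * i) (b * j) (i - 1) (j - 1) \<xi>"
    unfolding * axial_He1 by (simp only: ring_distribs mult_1_left mult_ac add_ac)
  finally show ?thesis .
qed

lemma
  shows integrable_He_axial: "integrable lborel (\<lambda>\<xi>. He \<alpha> \<xi> * axial a b i j \<xi> * \<omega> \<xi>)"
    and ip_He_axial: "ip_\<omega> (He \<alpha>) (axial a b i j)
      = a * ip_\<omega> (He \<alpha>) (He (i *s \<ee> 2))
        + b * (ip_\<omega> (He \<alpha>) (He (2 *s \<ee> 1 + j *s \<ee> 2)) + ip_\<omega> (He \<alpha>) (He (2 *s \<ee> 3 + j *s \<ee> 2)))"
proof -
  let ?p = "\<lambda>\<xi>. 1 * He (2 *s \<ee> 1 + j *s \<ee> 2) \<xi> + 1 * He (2 *s \<ee> 3 + j *s \<ee> 2) \<xi>"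
  have axial: "axial a b i j = (\<lambda>\<xi>. a * He (i *s \<ee> 2) \<xi> + b * ?p \<xi>)"
    by (simp add: axial_def fun_eq_iff)
  have p: "integrable lborel (\<lambda>\<xi>. ?p \<xi> * He \<alpha> \<xi> * \<omega> \<xi>)"
    by (rule integrable_lincomb integrable_He_He)+
  show "integrable lborel (\<lambda>\<xi>. He \<alpha> \<xi> * axial a b i j \<xi> * \<omega> \<xi>)"
    using integrable_lincomb[OF integrable_He_He p, of a "i *s \<ee> 2" b]
    by (simp add: axial mult.commute)
  show "ip_\<omega> (He \<alpha>) (axial a b i j)
      = a * ip_\<omega> (He \<alpha>) (He (i *s \<ee> 2))
        + b * (ip_\<omega> (He \<alpha>) (He (2 *s \<ee> 1 + j *s \<ee> 2)) + ip_\<omega> (He \<alpha>) (He (2 *s \<ee> 3 + j *s \<ee> 2)))"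
    unfolding ip_commute[of "He \<alpha>"] axial
    by (simp only: ip_lincomb[OF integrable_He_He p] ip_lincomb[OF integrable_He_He integrable_He_He])
      simp
qed

text \<open>The three multi-indices in \<open>axial\<close> are distinct, so cross terms vanish. The
  two off-axis ones contribute \<open>2! * j!\<close> each, hence the factor 4.\<close>

lemma
  shows integrable_axial_axial:
      "integrable lborel (\<lambda>\<xi>. axial a b i j \<xi> * axial a' b' i' j' \<xi> * \<omega> \<xi>)"
    and ip_axial_axial: "ip_\<omega> (axial a b i j) (axial a' b' i' j')
      = a * a' * (of_bool (i = i') * fact i) + 4 * b * b' * (of_bool (j = j') * fact j)"
proof -
  let ?r = "axial a' b' i' j'"
  let ?p = "\<lambda>\<xi>. 1 * He (2 *s \<ee> 1 + j *s \<ee> 2) \<xi> + 1 * He (2 *s \<ee> 3 + j *s \<ee> 2) \<xi>"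
  have axial: "axial a b i j = (\<lambda>\<xi>. a * He (i *s \<ee> 2) \<xi> + b * ?p \<xi>)"
    by (simp add: axial_def fun_eq_iff)
  have p: "integrable lborel (\<lambda>\<xi>. ?p \<xi> * ?r \<xi> * \<omega> \<xi>)"
    by (rule integrable_lincomb integrable_He_axial)+
  show "integrable lborel (\<lambda>\<xi>. axial a b i j \<xi> * ?r \<xi> * \<omega> \<xi>)"
    unfolding axial by (rule integrable_lincomb[OF integrable_He_axial p])
  have "ip_\<omega> (axial a b i j) ?r = a * ip_\<omega> (He (i *s \<ee> 2)) ?r
      + b * (ip_\<omega> (He (2 *s \<ee> 1 + j *s \<ee> 2)) ?r + ip_\<omega> (He (2 *s \<ee> 3 + j *s \<ee> 2)) ?r)"
    unfolding axial
    by (simp only: ip_lincomb[OF integrable_He_axial p]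
        ip_lincomb[OF integrable_He_axial integrable_He_axial]) simp
  also have "\<dots> = a * a' * (of_bool (i = i') * fact i) + 4 * b * b' * (of_bool (j = j') * fact j)"
    unfolding ip_He_axial ip_He_He prod_UNIV_3 vector_add_component vector_smult_component
      ee_component axial_index_eq
    by (simp add: fact_numeral algebra_simps)
  finally show "ip_\<omega> (axial a b i j) ?r
      = a * a' * (of_bool (i = i') * fact i) + 4 * b * b' * (of_bool (j = j') * fact j)" .
qed

text \<open>The raising and the lowering part of \<open>xi2_mult_axial\<close> each match one
  neighbouring degree; the lowering coefficient \<open>i'\<close> turns \<open>fact (i' - 1)\<close>
  into \<open>fact i'\<close>.\<close>

lemma ip_axial_xi2_axial:
  "ip_\<omega> (axial a b i j) (\<lambda>\<xi>. \<xi> $ 2 * axial a' b' i' j' \<xi>)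
    = a * a' * (of_bool (i = Suc i') * fact i + of_bool (i' = Suc i) * fact i')
      + 4 * b * b' * (of_bool (j = Suc j') * fact j + of_bool (j' = Suc j) * fact j')"
  unfolding xi2_mult_axial ip_commute[of "axial a b i j"]
    ip_lincomb[OF integrable_axial_axial integrable_axial_axial] ip_axial_axial
  by (cases i'; cases j') (auto simp: algebra_simps)

text \<open>An index belonging to a zero coefficient is a dummy value.\<close>

lemma phi_axial:
  "phi (Suc 0) = axial 1 (- 1 / 2) 2 0"
  "even n \<Longrightarrow> phi n = axial 1 0 (n + 2) 0"
  "odd n \<Longrightarrow> n \<noteq> 1 \<Longrightarrow> phi n = axial 0 (1 / 2) 0 (n - 1)"
  by (auto simp: phi_def axial_def fun_eq_iff)

lemma varphi_axial:
  "varphi (Suc 0) = axial 1 (- 3 / 2) 3 1"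
  "even n \<Longrightarrow> varphi n = axial 1 0 (n + 3) 0"
  "odd n \<Longrightarrow> n \<noteq> 1 \<Longrightarrow> varphi n = axial 0 (1 / 2) 0 n"
  by (auto simp: varphi_def axial_def fun_eq_iff)

text \<open>The coefficient 1/2 cancels the factor 4 of \<open>ip_axial_axial\<close>; the
  exceptional value is 3 = 2! + 0!.\<close>

lemma norm_phi: "ip_\<omega> (phi n) (phi n) = (if n = 1 then 3 else if even n then fact (n + 2) else fact (n - 1))"
  by (auto simp: phi_axial ip_axial_axial numeral_eq_Suc)

text \<open>Here the exceptional value is 15 = 3! + 9 * 1!.\<close>

lemma norm_varphi: "ip_\<omega> (varphi n) (varphi n) = (if n = 1 then 15 else if even n then fact (n + 3) else fact n)"
  by (auto simp: varphi_axial ip_axial_axial numeral_eq_Suc)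

lemma a_coef_pos: "a_coef n > 0" and b_coef_pos: "b_coef n > 0"
  by (simp_all add: a_coef_def b_coef_def norm_phi norm_varphi)

lemma a_coef_square: "a_coef n * a_coef n = ip_\<omega> (phi n) (phi n)"
  and b_coef_square: "b_coef n * b_coef n = ip_\<omega> (varphi n) (varphi n)"
  using a_coef_pos[of n] b_coef_pos[of n] by (simp_all add: a_coef_def b_coef_def)

text \<open>The entries of \<open>M0\<close> before division by the norms; they are integers, and
  square roots enter only in the final assembly.\<close>

definition coupling :: "nat \<Rightarrow> nat \<Rightarrow> real" where
  "coupling m n = ip_\<omega> (phi m) (\<lambda>\<xi>. \<xi> $ 2 * varphi n \<xi>)"

lemma coupling_1_1: "coupling (Suc 0) (Suc 0) = 9"
  by (simp add: coupling_def phi_axial varphi_axial ip_axial_xi2_axial numeral_eq_Suc)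

lemma coupling_1: "m \<ge> 2 \<Longrightarrow>
    coupling m (Suc 0) = (if m = 2 then 24 else if m = 3 then - 6 else 0)"
  by (cases "even m") 
    (auto simp: coupling_def phi_axial varphi_axial ip_axial_xi2_axial fact_numeral)

lemma coupling_1_left: "n \<ge> 2 \<Longrightarrow> coupling (Suc 0) n = 0"
  by (cases "even n") (auto simp: coupling_def phi_axial varphi_axial ip_axial_xi2_axial)

text \<open>Opposite parities pair an on-axis with an off-axis polynomial, which are orthogonal. For
  equal parities the degrees in \<open>\<xi>\<^sub>2\<close> must differ by one:
  \<open>phi m\<close> is one below \<open>varphi n\<close> if \<open>m = n\<close> and one above if
  \<open>m = n + 2\<close>.\<close>

lemma coupling_ge_2: "m \<ge> 2 \<Longrightarrow> n \<ge> 2 \<Longrightarrow> coupling m n =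
    (if m = n then (if even n then fact (n + 3) else fact n)
     else if m = n + 2 then (if even n then fact (n + 4) else fact (n + 1)) else 0)"
  by (cases "even m"; cases "even n")
    (auto simp: coupling_def phi_axial varphi_axial ip_axial_xi2_axial numeral_eq_Suc
      even_Suc_Suc_iff[unfolded numeral_2_eq_2])

section \<open>The moment equations in the reduced unknowns\<close>

locale nontrivial_interval =
  fixes S :: "real set"
  assumes interval: "is_interval S" and interior: "interior S \<noteq> {}"
begin

text \<open>A connected set other than a singleton has no isolated point. This makes derivatives
  within \<open>S\<close> unique.\<close>

lemma at_within_neq_bot: "y \<in> S \<Longrightarrow> at y within S \<noteq> bot"
proof -
  assume "y \<in> S"
  have "S \<noteq> {x}" for x
    using interior by auto
  then show ?thesis
    using connected_imp_perfect[OF is_interval_connected[OF interval] \<open>y \<in> S\<close>]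
    by (simp add: trivial_limit_within)
qed

lemma ddyI: "(g has_vector_derivative d) (at y within S) \<Longrightarrow> y \<in> S \<Longrightarrow> ddy S g y = d"
  unfolding ddy_def by (intro vector_derivative_within at_within_neq_bot)

lemma ddy_works: "g differentiable_on S \<Longrightarrow> y \<in> S \<Longrightarrow>
    (g has_vector_derivative ddy S g y) (at y within S)"
  unfolding ddy_def by (simp add: differentiable_on_def vector_derivative_works[symmetric])

lemma ddy_add: "g differentiable_on S \<Longrightarrow> h differentiable_on S \<Longrightarrow> y \<in> S \<Longrightarrow>
    ddy S (\<lambda>z. g z + h z) y = ddy S g y + ddy S h y"
  by (intro ddyI has_vector_derivative_add ddy_works)

lemma ddy_diff: "g differentiable_on S \<Longrightarrow> h differentiable_on S \<Longrightarrow> y \<in> S \<Longrightarrow>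
    ddy S (\<lambda>z. g z - h z) y = ddy S g y - ddy S h y"
  by (intro ddyI has_vector_derivative_diff ddy_works)

lemma ddy_cmult: "g differentiable_on S \<Longrightarrow> y \<in> S \<Longrightarrow> ddy S (\<lambda>z. c * g z) y = c * ddy S g y"
  using has_vector_derivative_scaleR[OF DERIV_const ddy_works, of g y c]
  by (intro ddyI) (auto simp: scaleR_conv_of_real)

lemma differentiable_on_cmult: "g differentiable_on S \<Longrightarrow> (\<lambda>z. c * g z) differentiable_on S"
  for g :: "real \<Rightarrow> real"
  by (intro differentiable_on_mult differentiable_on_const)

lemma ddy_const: "y \<in> S \<Longrightarrow> ddy S (\<lambda>z. c) y = 0"
  by (intro ddyI has_vector_derivative_const)

lemma ddy_cong: "(\<And>z. z \<in> S \<Longrightarrow> g z = h z) \<Longrightarrow> y \<in> S \<Longrightarrow> ddy S g y = ddy S h y"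
  unfolding ddy_def by (intro vector_derivative_cong_eq) auto

end

section \<open>Evaluation of \<open>hbar\<close> and \<open>Qbar\<close> by the length of the
  index\<close>

lemma mlen_simps [simp]:
  "mlen (\<alpha> + \<beta>) = mlen \<alpha> + mlen \<beta>" "mlen (c *s \<alpha>) = c * mlen \<alpha>" "mlen (\<ee> k) = 1"
  by (simp_all add: mlen_def sum.distrib sum_distrib_left \<ee>_def axis_def)

lemma hbar_ge_3: "mlen \<alpha> \<ge> 3 \<Longrightarrow> hbar f \<theta> u \<alpha> = f \<alpha>"
proof -
  assume "mlen \<alpha> \<ge> 3"
  then have "\<alpha> \<noteq> \<ee> k" "\<alpha> \<noteq> 2 *s \<ee> k" for k by auto
  then show ?thesis by (simp add: hbar_def fun_eq_iff)
qed

lemma ee_eq_iff [simp]: "\<ee> i = \<ee> j \<longleftrightarrow> i = j"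
  by (auto simp: \<ee>_def axis_eq_axis)

lemma smult_ee_eq_iff [simp]: "2 *s \<ee> i = 2 *s \<ee> j \<longleftrightarrow> i = j"
proof -
  have "2 *s \<alpha> = 2 *s \<beta> \<longleftrightarrow> \<alpha> = \<beta>" for \<alpha> \<beta> :: "nat^3"
    by (simp add: vec_eq_iff)
  then show ?thesis by simp
qed

lemma smult_ee_neq_ee [simp]: "2 *s \<ee> i \<noteq> \<ee> j"
  using mlen_simps by (metis mult_1_right numeral_One numeral_eq_iff semiring_norm(85))

lemma hbar_2_ee: "hbar f \<theta> u (2 *s \<ee> k) = (\<lambda>y. f (2 *s \<ee> k) y + 1 / 2 * \<theta> y)"
proof -
  have "(\<Sum>i\<in>UNIV. of_bool (k = i) * \<theta> y) = \<theta> y" for y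
    by (subst sum.remove[of _ k]) auto
  then show ?thesis
    by (auto simp: hbar_def)
qed

lemma hbar_ee: "hbar f \<theta> u (\<ee> k) = (\<lambda>y. f (\<ee> k) y + u k y)"
proof -
  have "(\<Sum>i\<in>UNIV. of_bool (k = i) * u i y) = u k y" for y
    by (subst sum.remove[of _ k]) auto
  moreover have "\<ee> k \<noteq> 2 *s \<ee> i" for i
    using smult_ee_neq_ee by metis
  ultimately show ?thesis
    by (auto simp: hbar_def)
qed

text \<open>Writing the index as \<open>\<alpha> + \<ee> 2\<close> avoids truncated
  subtraction.\<close>

lemma hbar_pred_raise: "hbar_pred f \<theta> u (\<alpha> + \<ee> 2) = hbar f \<theta> u \<alpha>"
proof -
  have "(\<alpha> + \<ee> 2) $ 2 \<noteq> 0" "\<alpha> + \<ee> 2 - \<ee> 2 = \<alpha>"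
    by (simp_all add: \<ee>_def vec_eq_iff)
  then show ?thesis
    by (simp only: hbar_pred_def fun_eq_iff if_False simp_thms)
qed

lemma hbar_pred_0: "\<alpha> $ 2 = 0 \<Longrightarrow> hbar_pred f \<theta> u \<alpha> = (\<lambda>y. 0)"
  by (simp add: hbar_pred_def fun_eq_iff)

lemma Qbar_no_flux: "mlen \<alpha> \<ge> 2 \<Longrightarrow> mlen \<alpha> \<noteq> 3 \<Longrightarrow> Qbar Pr f \<alpha> y = f \<alpha> y"
proof -
  assume "mlen \<alpha> \<ge> 2" "mlen \<alpha> \<noteq> 3"
  then have "\<alpha> \<noteq> \<ee> i + 2 *s \<ee> j" for i j by auto
  then show ?thesis
    using \<open>mlen \<alpha> \<ge> 2\<close> by (simp add: Qbar_def)
qed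

text \<open>The direction \<open>k\<close> is the only odd component of the index, and
  \<open>j\<close> is then determined; the double sum has a single term.\<close>

lemma Qbar_flux: "Qbar Pr f (\<ee> k + 2 *s \<ee> j) y = f (\<ee> k + 2 *s \<ee> j) y - (1 - Pr) / 5 * qbar f k y"
proof -
  have "\<ee> k + 2 *s \<ee> j = \<ee> k' + 2 *s \<ee> j' \<longleftrightarrow> k = k' \<and> j = j'" for k' j'
    using exhaust_3[of k] exhaust_3[of j] exhaust_3[of k'] exhaust_3[of j']
    by (elim disjE) (simp_all add: \<ee>_def axis_def vec_eq_iff forall_3)
  then have "(\<Sum>k'\<in>UNIV. \<Sum>j'\<in>UNIV. of_bool (\<ee> k + 2 *s \<ee> j = \<ee> k' + 2 *s \<ee> j') * qbar f k' y)
      = (\<Sum>k'\<in>UNIV. \<Sum>j'\<in>UNIV. if j' = j then (if k' = k then qbar f k' y else 0) else 0)"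
    by (intro sum.cong) auto
  also have "\<dots> = qbar f k y" by simp
  finally show ?thesis by (simp add: Qbar_def)
qed

section \<open>The scalar equations used in the rows\<close>

locale moment_system = nontrivial_interval S for S +
  fixes M :: nat and Kn Pr :: real
    and f :: "nat^3 \<Rightarrow> real \<Rightarrow> real" and \<theta> :: "real \<Rightarrow> real" and u :: "3 \<Rightarrow> real \<Rightarrow> real"
  assumes M: "M \<ge> 3" and sol: "moment_solution M Kn Pr S f \<theta> u"
begin

abbreviation "D \<equiv> ddy S"

lemma diff_f: "mlen \<alpha> \<le> M \<Longrightarrow> f \<alpha> differentiable_on S" and diff_\<theta>: "\<theta> differentiable_on S"
  using sol by (auto simp: moment_solution_def)

lemma constraints: "y \<in> S \<Longrightarrow> f (\<ee> i) y = 0" "y \<in> S \<Longrightarrow> u 2 y = 0"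
    "y \<in> S \<Longrightarrow> f (2 *s \<ee> 1) y + f (2 *s \<ee> 2) y + f (2 *s \<ee> 3) y = 0"
  using sol by (auto simp: moment_solution_def sum_3)

lemma equation: "y \<in> S \<Longrightarrow> mlen \<alpha> \<le> M \<Longrightarrow>
    D (hbar_pred f \<theta> u \<alpha>) y
      + (1 - of_bool (mlen \<alpha> = M)) * real (\<alpha> $ 2 + 1) * D (hbar f \<theta> u (\<alpha> + \<ee> 2)) y
    = - (1 / Kn) * Qbar Pr f \<alpha> y"
  using sol by (auto simp: moment_solution_def)

lemma Suc_smult_ee_2: "k *s \<ee> 2 + \<ee> 2 = Suc k *s \<ee> 2" "2 *s \<ee> i + k *s \<ee> 2 + \<ee> 2 = 2 *s \<ee> i + Suc k *s \<ee> 2"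
  by (simp_all add: vec_eq_iff)

lemma ee_2_component: "\<ee> 2 $ 2 = 1" "(k *s \<ee> 2) $ 2 = k" "i \<noteq> 2 \<Longrightarrow> \<ee> i $ 2 = 0"
  by (simp_all add: \<ee>_def axis_def)

text \<open>The first term keeps \<open>hbar\<close> because it still contains \<theta> for
  \<open>k = 2\<close>; the second index has length at least 4, where \<open>hbar\<close> is just
  \<open>f\<close>. At order \<open>M\<close> the factor 0 removes a moment that is not an
  unknown.\<close>

lemma equation_axis: "y \<in> S \<Longrightarrow> 2 \<le> k \<Longrightarrow> k < M \<Longrightarrow>
    D (hbar f \<theta> u (k *s \<ee> 2)) y
      + (1 - of_bool (Suc k = M)) * real (k + 2) * D (f ((k + 2) *s \<ee> 2)) y
    = - (1 / Kn) * Qbar Pr f (Suc k *s \<ee> 2) y"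
proof -
  assume y: "y \<in> S" and k: "2 \<le> k" "k < M"
  have *: "hbar_pred f \<theta> u (Suc k *s \<ee> 2) = hbar f \<theta> u (k *s \<ee> 2)"
    "hbar f \<theta> u (Suc k *s \<ee> 2 + \<ee> 2) = f ((k + 2) *s \<ee> 2)"
    using k hbar_pred_raise[of f \<theta> u "k *s \<ee> 2"] by (simp_all add: Suc_smult_ee_2 hbar_ge_3)
  show ?thesis
    using equation[OF y, of "Suc k *s \<ee> 2", unfolded *] k
    by (cases "Suc k = M") (auto simp: ee_2_component)
qed

text \<open>Here the first term contains \<theta> exactly for \<open>k = 0\<close>.\<close>

lemma equation_off_axis: "y \<in> S \<Longrightarrow> i \<noteq> 2 \<Longrightarrow> k + 2 < M \<Longrightarrow>
    D (hbar f \<theta> u (2 *s \<ee> i + k *s \<ee> 2)) y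
      + (1 - of_bool (k + 3 = M)) * real (k + 2) * D (f (2 *s \<ee> i + (k + 2) *s \<ee> 2)) y
    = - (1 / Kn) * Qbar Pr f (2 *s \<ee> i + Suc k *s \<ee> 2) y"
proof -
  assume y: "y \<in> S" and i: "i \<noteq> 2" and k: "k + 2 < M"
  have *: "hbar_pred f \<theta> u (2 *s \<ee> i + Suc k *s \<ee> 2) = hbar f \<theta> u (2 *s \<ee> i + k *s \<ee> 2)"
    "hbar f \<theta> u (2 *s \<ee> i + Suc k *s \<ee> 2 + \<ee> 2) = f (2 *s \<ee> i + (k + 2) *s \<ee> 2)"
    using hbar_pred_raise[of f \<theta> u "2 *s \<ee> i + k *s \<ee> 2"] by (simp_all add: Suc_smult_ee_2 hbar_ge_3)
  show ?thesis
    using equation[OF y, of "2 *s \<ee> i + Suc k *s \<ee> 2", unfolded *] k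
    by (cases "k + 3 = M") (auto simp: ee_2_component i)
qed

lemma diff_tbar: "i + 2 \<le> M \<Longrightarrow> tbar f i differentiable_on S"
  unfolding tbar_def[abs_def] by (simp add: diff_f)

lemma diff_gbar: "i + 2 \<le> M \<Longrightarrow> gbar f i differentiable_on S"
  unfolding gbar_def[abs_def] by (intro differentiable_on_add) (simp_all add: diff_f)

lemma D_gbar: "y \<in> S \<Longrightarrow> i + 2 \<le> M \<Longrightarrow>
    D (gbar f i) y = D (f (2 *s \<ee> 1 + i *s \<ee> 2)) y + D (f (2 *s \<ee> 3 + i *s \<ee> 2)) y"
  unfolding gbar_def[abs_def] by (intro ddy_add) (simp_all add: diff_f)

lemma D_hbar_2: "y \<in> S \<Longrightarrow> D (hbar f \<theta> u (2 *s \<ee> k)) y = D (f (2 *s \<ee> k)) y + 1 / 2 * D \<theta> y"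
proof -
  assume y: "y \<in> S"
  have f: "f (2 *s \<ee> k) differentiable_on S"
    using M by (simp add: diff_f)
  show ?thesis
    unfolding hbar_2_ee ddy_add[OF f differentiable_on_cmult[OF diff_\<theta>] y] ddy_cmult[OF diff_\<theta> y] ..
qed

lemma tbar_0: "tbar f 0 = f (2 *s \<ee> 2)" and tbar_1: "tbar f 1 = f (3 *s \<ee> 2)"
  and tbar_2: "tbar f 2 = f (4 *s \<ee> 2)"
  by (simp_all add: tbar_def fun_eq_iff eval_nat_numeral)

lemma gbar_1: "gbar f 1 y = f (2 *s \<ee> 1 + \<ee> 2) y + f (2 *s \<ee> 3 + \<ee> 2) y"
  by (simp add: gbar_def)

text \<open>The summand \<open>d = 2\<close> is a third copy of the moment at
  \<open>3 *s \<ee> 2\<close>.\<close>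

lemma qbar_eq: "qbar f 2 y = 3 * tbar f 1 y + gbar f 1 y"
proof -
  have "\<ee> 2 + 2 *s \<ee> 2 = 3 *s \<ee> 2"
    by (simp add: vec_eq_iff)
  then show ?thesis
    by (simp add: qbar_def tbar_1[unfolded One_nat_def] gbar_1[unfolded One_nat_def] sum_3 add.commute[of "\<ee> 2"])
qed

text \<open>The equation at \<open>2 *s \<ee> 2\<close>, whose predecessor term is the derivative of
  \<open>f (\<ee> 2) + u 2\<close>, zero by the constraints.\<close>

lemma D_tbar_1: "y \<in> S \<Longrightarrow> 3 * D (tbar f 1) y = - (1 / Kn) * tbar f 0 y"
proof -
  assume y: "y \<in> S"
  have e: "2 *s \<ee> 2 = \<ee> 2 + \<ee> 2" "2 *s \<ee> 2 + \<ee> 2 = 3 *s \<ee> 2"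
    by (simp_all add: vec_eq_iff)
  have "D (hbar_pred f \<theta> u (2 *s \<ee> 2)) y = D (\<lambda>y. 0) y"
    unfolding e hbar_pred_raise hbar_ee by (rule ddy_cong) (auto simp: y constraints)
  then show ?thesis
    using equation[OF y, of "2 *s \<ee> 2"] M y
    by (simp add: e(2) ddy_const hbar_ge_3 Qbar_no_flux tbar_0 tbar_1[unfolded One_nat_def] ee_2_component)
qed

text \<open>The equations at \<open>2 *s \<ee> 1\<close> and \<open>2 *s \<ee> 3\<close> have no
  predecessor term; the trace constraint expresses their sources by \<open>tbar f 0\<close>.\<close>

lemma D_gbar_1: "y \<in> S \<Longrightarrow> D (gbar f 1) y = 1 / Kn * tbar f 0 y"
proof -
  assume y: "y \<in> S"
  have "D (f (2 *s \<ee> i + \<ee> 2)) y = - (1 / Kn) * f (2 *s \<ee> i) y" if "i \<noteq> 2" for i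
  proof -
    have "(2 *s \<ee> i) $ 2 = 0"
      using that by (simp add: \<ee>_def axis_def)
    then show ?thesis
      using equation[OF y, of "2 *s \<ee> i"] M y
      by (simp add: hbar_pred_0 ddy_const hbar_ge_3 Qbar_no_flux)
  qed
  from this[of 1] this[of 3] constraints(3)[OF y] D_gbar[OF y, of 1] M
  have "D (gbar f 1) y = - (1 / Kn) * (f (2 *s \<ee> 1) y + f (2 *s \<ee> 3) y)"
    by (simp add: algebra_simps)
  also have "f (2 *s \<ee> 1) y + f (2 *s \<ee> 3) y = - tbar f 0 y"
    using constraints(3)[OF y] by (simp add: tbar_0)
  finally show ?thesis by simp
qed

lemma D_qbar: "y \<in> S \<Longrightarrow> D (qbar f 2) y = 0"
proof -
  assume y: "y \<in> S"
  have "D (qbar f 2) y = D (\<lambda>z. 3 * tbar f 1 z + gbar f 1 z) y"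
    by (intro arg_cong[of _ _ "\<lambda>g. D g y"] ext qbar_eq)
  also have "\<dots> = 3 * D (tbar f 1) y + D (gbar f 1) y"
    using M y by (subst ddy_add) 
      (auto simp: ddy_cmult diff_tbar diff_gbar intro!: differentiable_on_cmult)
  also have "\<dots> = 0"
    using D_tbar_1[OF y] D_gbar_1[OF y] by simp
  finally show ?thesis .
qed

text \<open>The equation at \<open>3 *s \<ee> 2\<close>, where both \<theta> and the heat flux
  enter.\<close>

lemma D_tbar_2: "y \<in> S \<Longrightarrow> D (tbar f 0) y + 1 / 2 * D \<theta> y
    + (1 - of_bool (M = 3)) * (4 * D (tbar f 2) y) = - (1 / Kn) * (tbar f 1 y - (1 - Pr) / 5 * qbar f 2 y)"
proof -
  assume y: "y \<in> S"
  have "3 *s \<ee> 2 = \<ee> 2 + 2 *s \<ee> 2"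
    by (simp add: vec_eq_iff)
  moreover have "D (hbar f \<theta> u (2 *s \<ee> 2)) y = D (tbar f 0) y + 1 / 2 * D \<theta> y"
    using D_hbar_2[OF y, of 2] by (simp add: tbar_0)
  ultimately show ?thesis
    using equation_axis[OF y, of 2] M
    by (cases "M = 3") (simp_all add: Qbar_flux tbar_0 tbar_1[unfolded One_nat_def] tbar_2 eq_commute[of 3])
qed

text \<open>The sum of the equations at \<open>2 *s \<ee> i + \<ee> 2\<close> for
  \<open>i = 1, 3\<close>; each contributes half the derivative of \<theta> and one flux
  term.\<close>

lemma D_gbar_2: "y \<in> S \<Longrightarrow> - D (tbar f 0) y + D \<theta> y
    + (1 - of_bool (M = 3)) * (2 * D (gbar f 2) y)
    = - (1 / Kn) * (gbar f 1 y - 2 * (1 - Pr) / 5 * qbar f 2 y)"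
proof -
  assume y: "y \<in> S"
  have *: "D (f (2 *s \<ee> i)) y + 1 / 2 * D \<theta> y 
      + (1 - of_bool (M = 3)) * (2 * D (f (2 *s \<ee> i + 2 *s \<ee> 2)) y)
    = - (1 / Kn) * (f (2 *s \<ee> i + 1 *s \<ee> 2) y - (1 - Pr) / 5 * qbar f 2 y)" if i: "i \<noteq> 2" for i
  proof -
    have "D (hbar f \<theta> u (2 *s \<ee> i)) y = D (f (2 *s \<ee> i)) y + 1 / 2 * D \<theta> y"
      by (rule D_hbar_2[OF y])
    then show ?thesis
      using equation_off_axis[OF y i, of 0] M Qbar_flux[of Pr f 2 i y]
      by (cases "M = 3") (simp_all add: add.commute[of "\<ee> 2"] eq_commute[of 3] numeral_2_eq_2)
  qed
  \<comment> \<open>The trace constraint holds on all of \<open>S\<close> and may therefore be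
    differentiated.\<close>
  have "D (f (2 *s \<ee> 1)) y + D (f (2 *s \<ee> 3)) y + D (tbar f 0) y
      = D (\<lambda>z. f (2 *s \<ee> 1) z + f (2 *s \<ee> 3) z + tbar f 0 z) y"
    using M y by (simp add: ddy_add diff_f diff_tbar differentiable_on_add)
  also have "\<dots> = D (\<lambda>z. 0) y"
    using y constraints(3) by (intro ddy_cong) (auto simp: tbar_0 algebra_simps)
  finally have t0: "D (f (2 *s \<ee> 1)) y + D (f (2 *s \<ee> 3)) y = - D (tbar f 0) y"
    using y by (simp add: ddy_const)
  show ?thesis
  proof (cases "M = 3")
    case True
    then show ?thesis
      using *[of 1] *[of 3] t0 by (simp add: gbar_def diff_divide_distrib algebra_simps)
  next
    case False
    then show ?thesis
      using *[of 1] *[of 3] t0 D_gbar[OF y, of 2] M 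
      by (simp add: gbar_def diff_divide_distrib algebra_simps)
  qed
qed

text \<open>From \<open>i = 1\<close> on the indices are too long for \<theta> and for the flux
  correction.\<close>

lemma D_tbar: "y \<in> S \<Longrightarrow> 1 \<le> i \<Longrightarrow> i + 3 \<le> M \<Longrightarrow> D (tbar f i) y
    + (1 - of_bool (i + 3 = M)) * (real (i + 4) * D (tbar f (i + 2)) y) = - (1 / Kn) * tbar f (i + 1) y"
  using equation_axis[of y "i + 2"]
  by (simp add: Qbar_no_flux hbar_ge_3 tbar_def[abs_def] numeral_eq_Suc mult.assoc)

lemma D_gbar_ge_2: "y \<in> S \<Longrightarrow> 1 \<le> i \<Longrightarrow> i + 3 \<le> M \<Longrightarrow> D (gbar f i) y
    + (1 - of_bool (i + 3 = M)) * (real (i + 2) * D (gbar f (i + 2)) y) = - (1 / Kn) * gbar f (i + 1) y"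
proof -
  assume y: "y \<in> S" and i: "1 \<le> i" "i + 3 \<le> M"
  have *: "D (f (2 *s \<ee> j + i *s \<ee> 2)) y
     + (1 - of_bool (i + 3 = M)) * (real (i + 2) * D (f (2 *s \<ee> j + (i + 2) *s \<ee> 2)) y)
     = - (1 / Kn) * f (2 *s \<ee> j + (i + 1) *s \<ee> 2) y" if "j \<noteq> 2" for j
    using equation_off_axis[OF y that, of i] i by (simp add: Qbar_no_flux hbar_ge_3 mult.assoc)
  show ?thesis
  \<comment> \<open>At \<open>i + 3 = M\<close> the derivative of \<open>gbar f (i + 2)\<close>
    cannot be split, as its moments exceed order \<open>M\<close>, but its factor is 0.\<close>
  proof (cases "i + 3 = M")
    case True
    then show ?thesis
      using *[of 1] *[of 3] D_gbar[OF y, of i] i by (simp add: gbar_def algebra_simps)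
  next
    case False
    then show ?thesis
      using *[of 1] *[of 3] D_gbar[OF y, of i] D_gbar[OF y, of "i + 2"] i
      by (simp add: gbar_def algebra_simps)
  qed
qed

text \<open>Three times \<open>D_tbar_2\<close> plus \<open>D_gbar_2\<close> reproduces the heat
  flux on the right. The flux corrections add up to \<open>1 - Pr\<close> times it, so
  \<open>Pr\<close> times it remains; \<theta> gets the coefficient 3/2 + 1 = 5/2.\<close>

lemma D_\<theta>: "y \<in> S \<Longrightarrow> D \<theta> y = - (2/5) * (1 / Kn) * Pr * qbar f 2 y
       - 4/5 * D (\<lambda>z. tbar f 0 z + (1 - of_bool (M = 3)) * (6 * tbar f 2 z + gbar f 2 z)) y"
proof -
  assume y: "y \<in> S"
  let ?\<delta> = "1 - of_bool (M = 3) :: real"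
  have "D (\<lambda>z. tbar f 0 z + ?\<delta> * (6 * tbar f 2 z + gbar f 2 z)) y
      = D (tbar f 0) y + ?\<delta> * (6 * D (tbar f 2) y + D (gbar f 2) y)"
  \<comment> \<open>For \<open>M = 3\<close> the moments in the bracket are not unknowns and need
    not be differentiable; the factor 0 disposes of them.\<close>
  proof (cases "M = 3")
    case False
    have "6 * D (tbar f 2) y + D (gbar f 2) y = D (\<lambda>z. 6 * tbar f 2 z + gbar f 2 z) y"
      using M False y by (subst ddy_add)
        (auto simp: ddy_cmult diff_tbar diff_gbar intro!: differentiable_on_cmult)
    then show ?thesis
      using M False y by (simp, subst ddy_add) 
        (auto simp: diff_tbar diff_gbar intro!: differentiable_on_cmult differentiable_on_add)
  qed simp
  moreover have "5 / 2 * D \<theta> y = - (1 / Kn) * (Pr * qbar f 2 y)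
      - 2 * (D (tbar f 0) y + ?\<delta> * (6 * D (tbar f 2) y + D (gbar f 2) y))"
  proof -
    have "3 * (D (tbar f 0) y + 1 / 2 * D \<theta> y + ?\<delta> * (4 * D (tbar f 2) y))
        + (- D (tbar f 0) y + D \<theta> y + ?\<delta> * (2 * D (gbar f 2) y))
      = - (1 / Kn) * (3 * tbar f 1 y + gbar f 1 y - (1 - Pr) * qbar f 2 y)"
      unfolding D_tbar_2[OF y] D_gbar_2[OF y] by (simp add: algebra_simps add_divide_distrib diff_divide_distrib)
    then have "3 * (D (tbar f 0) y + 1 / 2 * D \<theta> y + ?\<delta> * (4 * D (tbar f 2) y))
        + (- D (tbar f 0) y + D \<theta> y + ?\<delta> * (2 * D (gbar f 2) y)) = - (1 / Kn) * (Pr * qbar f 2 y)"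
      unfolding qbar_eq[symmetric] by (simp add: algebra_simps)
    then show ?thesis by (simp add: algebra_simps)
  qed
  ultimately show ?thesis by (simp add: algebra_simps)
qed

end

section \<open>The matrix equation\<close>

text \<open>Position \<open>m\<close> occurs exactly when the order of its moment is at most
  \<open>M\<close>; for even and odd \<open>m\<close> this order is \<open>m + 2\<close> and
  \<open>m + 1\<close> in \<open>f_even\<close>, \<open>m + 3\<close> and \<open>m + 2\<close> in
  \<open>f_odd\<close>.\<close>

lemma m_even_m_odd:
  assumes "M \<ge> 3"
  shows "Suc 0 \<le> m_odd M" "m_odd M \<le> m_even M" "m_even M \<le> m_odd M + 2" "3 \<le> m_even M \<longleftrightarrow> M \<noteq> 3"
    and "even m \<Longrightarrow> m \<le> m_even M \<longleftrightarrow> m + 2 \<le> M" "odd m \<Longrightarrow> m \<le> m_even M \<longleftrightarrow> m + 1 \<le> M"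
    and "even m \<Longrightarrow> m \<le> m_odd M \<longleftrightarrow> m + 3 \<le> M" "odd m \<Longrightarrow> m \<le> m_odd M \<longleftrightarrow> m + 2 \<le> M"
  using assms unfolding m_even_def m_odd_def by presburger+

text \<open>The index of the only nonzero entry besides the diagonal one in row \<open>m \<ge> 2\<close>: rows \<open>2\<close> and
  \<open>3\<close> both couple to the combined polynomial \<open>varphi 1\<close>.\<close>

definition prev_odd :: "nat \<Rightarrow> nat" where
  "prev_odd m = (if m \<le> 3 then 1 else m - 2)"

text \<open>The bound \<open>m \<le> N + 2\<close> keeps \<open>prev_odd m\<close> in range, whereas
  in the last rows the diagonal index may exceed \<open>N\<close>.\<close>

lemma coupling_row_sum:
  assumes "2 \<le> m" "m \<le> N + 2" "Suc 0 \<le> N"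
  shows "(\<Sum>n=Suc 0..N. coupling m n * F n)
    = coupling m (prev_odd m) * F (prev_odd m) + (if m \<le> N then coupling m m * F m else 0)"
proof -
  have "(\<Sum>n=Suc 0..N. coupling m n * F n) = (\<Sum>n=Suc 0..N.
      (if n = prev_odd m then coupling m n * F n else 0) + (if n = m then coupling m n * F n else 0))"
  proof (intro sum.cong refl)
    fix n assume "n \<in> {Suc 0..N}"
    then consider "n = 1" | "n \<ge> 2" by fastforce
    then show "coupling m n * F n =
      (if n = prev_odd m then coupling m n * F n else 0) + (if n = m then coupling m n * F n else 0)"
      using assms by cases (auto simp: prev_odd_def coupling_1 coupling_ge_2)
  qed
  also have "\<dots> = coupling m (prev_odd m) * F (prev_odd m) + (if m \<le> N then coupling m m * F m else 0)"
    using assms by (auto simp: sum.distrib sum.delta' prev_odd_def)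
  finally show ?thesis .
qed

lemma coupling_row_sum_1:
  assumes "Suc 0 \<le> N"
  shows "(\<Sum>n=Suc 0..N. coupling (Suc 0) n * F n) = 9 * F (Suc 0)"
  using assms by (subst sum.atLeast_Suc_atMost)
    (auto simp: coupling_1_1 coupling_1_left intro!: sum.neutral)

text \<open>Row 1 couples only to \<open>varphi 1\<close>, so from column 2 on at most the rows
  \<open>n\<close> and \<open>n + 2\<close> contribute.\<close>

lemma coupling_column_sum:
  assumes "2 \<le> n" "n \<le> N"
  shows "(\<Sum>m=Suc 0..N. coupling m n * F m)
    = coupling n n * F n + (if n + 2 \<le> N then coupling (n + 2) n * F (n + 2) else 0)"
proof -
  have "(\<Sum>m=Suc 0..N. coupling m n * F m) = (\<Sum>m=Suc 0..N.
      (if m = n then coupling m n * F m else 0) + (if m = n + 2 then coupling m n * F m else 0))"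
  proof (intro sum.cong refl)
    fix m assume "m \<in> {Suc 0..N}"
    then consider "m = 1" | "m \<ge> 2" by fastforce
    then show "coupling m n * F m =
      (if m = n then coupling m n * F m else 0) + (if m = n + 2 then coupling m n * F m else 0)"
      using assms by cases (auto simp: coupling_1_left coupling_ge_2)
  qed
  also have "\<dots> = coupling n n * F n + (if n + 2 \<le> N then coupling (n + 2) n * F (n + 2) else 0)"
    using assms by (auto simp: sum.distrib sum.delta')
  finally show ?thesis .
qed

text \<open>Excluding \<open>N = 2\<close> makes rows 2 and 3 appear together;
  \<open>m_even M\<close> is odd for \<open>M \<ge> 3\<close>.\<close>

lemma coupling_column_sum_1:
  assumes "Suc 0 \<le> N" "N \<noteq> 2"
  shows "(\<Sum>m=Suc 0..N. coupling m (Suc 0) * F m)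
    = 9 * F (Suc 0) + (if 3 \<le> N then 24 * F 2 - 6 * F 3 else 0)"
proof -
  have "(\<Sum>m=Suc 0..N. coupling m (Suc 0) * F m) = (\<Sum>m=Suc 0..N.
      (if m = 1 then 9 * F 1 else 0) + (if m = 2 then 24 * F 2 else 0) + (if m = 3 then - 6 * F 3 else 0))"
  proof (intro sum.cong refl)
    fix m assume "m \<in> {Suc 0..N}"
    then consider "m = 1" | "m \<ge> 2" by fastforce
    then show "coupling m (Suc 0) * F m =
      (if m = 1 then 9 * F 1 else 0) + (if m = 2 then 24 * F 2 else 0) + (if m = 3 then - 6 * F 3 else 0)"
      using assms by cases (auto simp: coupling_1_1 coupling_1)
  qed
  also have "\<dots> = 9 * F (Suc 0) + (if 3 \<le> N then 24 * F 2 - 6 * F 3 else 0)"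
    using assms by (simp add: sum.distrib sum.delta')
  finally show ?thesis .
qed

text \<open>Brings row sums into the shape of the moment equations: \<open>a\<close> is the squared
  norm, \<open>r\<close> the factor of the higher moment, and \<open>e\<close> says that this moment
  exceeds order \<open>M\<close>.\<close>

lemma factor_if: "a * b + (if \<not> e then (r * a) * c else 0) = a * (b + (1 - of_bool e) * (r * c))"
  for a b c r :: real
  by (simp add: algebra_simps)

section \<open>Rows of the system before normalisation\<close>

context moment_system
begin

lemma diff_qbar: "qbar f 2 differentiable_on S"
proof -
  have "qbar f 2 = (\<lambda>y. 3 * tbar f 1 y + gbar f 1 y)"
    by (intro ext qbar_eq)
  then show ?thesis
    using M by (auto intro!: differentiable_on_add differentiable_on_cmult diff_tbar diff_gbar)
qed

lemma f_even_entry_eq: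
  "f_even_entry f (Suc 0) = tbar f 0" "even m \<Longrightarrow> f_even_entry f m = tbar f m"
  "odd m \<Longrightarrow> m \<noteq> Suc 0 \<Longrightarrow> f_even_entry f m = gbar f (m - 1)"
  by (auto simp: f_even_entry_def[abs_def])

lemma f_odd_entry_eq:
  "f_odd_entry f (Suc 0) = (\<lambda>y. tbar f 1 y - 1 / 5 * qbar f 2 y)"
  "even m \<Longrightarrow> f_odd_entry f m = tbar f (m + 1)"
  "odd m \<Longrightarrow> m \<noteq> Suc 0 \<Longrightarrow> f_odd_entry f m = gbar f m"
  by (auto simp: f_odd_entry_def[abs_def])

lemma diff_f_even_entry: "1 \<le> m \<Longrightarrow> m \<le> m_even M \<Longrightarrow> f_even_entry f m differentiable_on S"
  using M by (cases "m = Suc 0"; cases "even m")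
    (auto simp: f_even_entry_eq m_even_m_odd intro!: diff_tbar diff_gbar)

lemma diff_f_odd_entry: "1 \<le> n \<Longrightarrow> n \<le> m_odd M \<Longrightarrow> f_odd_entry f n differentiable_on S"
proof -
  assume n: "1 \<le> n" "n \<le> m_odd M"
  have "f_odd_entry f (Suc 0) differentiable_on S"
    unfolding f_odd_entry_eq using M
    by (intro differentiable_on_diff differentiable_on_cmult diff_tbar diff_qbar) auto
  with n M show ?thesis
    by (cases "n = Suc 0"; cases "even n")
      (auto simp: f_odd_entry_eq m_even_m_odd intro!: diff_tbar diff_gbar)
qed

lemma D_f_odd_entry_1: "y \<in> S \<Longrightarrow> D (f_odd_entry f (Suc 0)) y = D (tbar f 1) y"
proof -
  assume y: "y \<in> S"
  have t: "tbar f 1 differentiable_on S"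
    using M by (intro diff_tbar) simp
  show ?thesis
    unfolding f_odd_entry_eq ddy_diff[OF t differentiable_on_cmult[OF diff_qbar] y]
      ddy_cmult[OF diff_qbar y] D_qbar[OF y] by simp
qed

lemma even_row:
  assumes y: "y \<in> S" and m: "1 \<le> m" "m \<le> m_even M"
  shows "(\<Sum>n=Suc 0..m_odd M. coupling m n * D (f_odd_entry f n) y)
    = - (1 / Kn) * (ip_\<omega> (phi m) (phi m) * f_even_entry f m y)"
proof -
  note bounds = m_even_m_odd[OF M]
  have "m = Suc 0 \<or> even m \<and> 2 \<le> m \<or> odd m \<and> 3 \<le> m"
    using m by presburger
  then consider "m = Suc 0" | "even m" "2 \<le> m" | "odd m" "3 \<le> m"
    by blast
  then show ?thesis
  proof cases
    case 1
    show ?thesis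
      unfolding 1 coupling_row_sum_1[OF bounds(1)] D_f_odd_entry_1[OF y]
      using D_tbar_1[OF y] by (simp add: norm_phi f_even_entry_eq)
  next
    case 2
    have prev: "coupling m (prev_odd m) * D (f_odd_entry f (prev_odd m)) y
        = fact (m + 2) * D (tbar f (m - 1)) y"
    proof (cases "m = 2")
      case True
      then show ?thesis
        by (simp add: prev_odd_def coupling_1 D_f_odd_entry_1[OF y] fact_numeral)
    next
      case False
      then have k: "even (m - 2)" "2 \<le> m - 2" "m - 2 + 1 = m - 1" "m - 2 + 4 = m + 2" "m = m - 2 + 2"
          "\<not> m \<le> 3" "m \<noteq> m - 2"
        using 2 by presburger+
      have "coupling m (m - 2) = fact (m + 2)"
        using coupling_ge_2[OF 2(2) k(2)] k(1,5,7) unfolding k(4) by presburger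
      moreover have "f_odd_entry f (m - 2) = tbar f (m - 1)"
        unfolding f_odd_entry_eq(2)[OF k(1)] k(3) ..
      ultimately show ?thesis
        unfolding prev_odd_def using k(6) by simp
    qed
    have diag: "coupling m m = real (m + 3) * fact (m + 2)"
      using 2 by (simp add: coupling_ge_2 fact_reduce[of "m + 3"])
    have arith: "m - 1 + 3 = m + 2" "m - 1 + 4 = m + 3" "m - 1 + 2 = m + 1" "m - 1 + 1 = m"
      using 2 by auto
    have prems: "1 \<le> m - 1" "m - 1 + 3 \<le> M"
      using 2 m bounds(5)[of m] by auto
    \<comment> \<open>The diagonal entry is missing exactly at the order where the moment equation
      loses its higher term.\<close>
    have last: "m \<le> m_odd M \<longleftrightarrow> \<not> m + 2 = M"
      using 2 m bounds(5,7)[of m] by auto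
    have "(\<Sum>n=Suc 0..m_odd M. coupling m n * D (f_odd_entry f n) y)
       = fact (m + 2) * (- (1 / Kn) * tbar f m y)"
      unfolding coupling_row_sum[OF 2(2) order_trans[OF m(2) bounds(3)] bounds(1)]
        prev diag last f_odd_entry_eq(2)[OF 2(1)] factor_if
        D_tbar[OF y prems, unfolded arith] ..
    then show ?thesis
      using 2 by (simp add: norm_phi f_even_entry_eq)
  next
    case 3
    have m2: "2 \<le> m"
      using 3 by simp
    have prev: "coupling m (prev_odd m) * D (f_odd_entry f (prev_odd m)) y
        = fact (m - 1) * D (gbar f (m - 2)) y"
    proof (cases "m = 3")
      case True
      \<comment> \<open>Row 3 contains \<open>tbar f 1\<close> instead of \<open>gbar f 1\<close>,
        but constancy of the heat flux gives
        \<open>- 6 * D (tbar f 1) y = 2 * D (gbar f 1) y\<close>, which fits the general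
        pattern.\<close>
      then show ?thesis
        using D_tbar_1[OF y] D_gbar_1[OF y]
        by (simp add: prev_odd_def coupling_1 D_f_odd_entry_1[OF y] fact_numeral)
    next
      case False
      then have k: "odd (m - 2)" "2 \<le> m - 2" "m - 2 \<noteq> Suc 0" "m - 2 + 1 = m - 1" "m = m - 2 + 2"
          "\<not> m \<le> 3" "m \<noteq> m - 2"
        using 3 by presburger+
      have "coupling m (m - 2) = fact (m - 1)"
        using coupling_ge_2[OF m2 k(2)] k(1,5,7) unfolding k(4) by presburger
      then show ?thesis
        unfolding prev_odd_def using k(6) f_odd_entry_eq(3)[OF k(1,3)] by simp
    qed
    have diag: "coupling m m = real m * fact (m - 1)"
      using 3 by (simp add: coupling_ge_2 fact_reduce[of m])
    have arith: "m - 2 + 3 = m + 1" "m - 2 + 2 = m" "m - 2 + 1 = m - 1"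
      using 3 by auto
    have prems: "1 \<le> m - 2" "m - 2 + 3 \<le> M"
      using 3 m bounds(6)[of m] by auto
    have last: "m \<le> m_odd M \<longleftrightarrow> \<not> m + 1 = M"
      using 3 m bounds(6,8)[of m] by auto
    have ne: "m \<noteq> Suc 0"
      using 3 by simp
    have "(\<Sum>n=Suc 0..m_odd M. coupling m n * D (f_odd_entry f n) y)
       = fact (m - 1) * (- (1 / Kn) * gbar f (m - 1) y)"
      unfolding coupling_row_sum[OF m2 order_trans[OF m(2) bounds(3)] bounds(1)]
        prev diag last f_odd_entry_eq(3)[OF 3(1) ne] factor_if
        D_gbar_ge_2[OF y prems, unfolded arith] ..
    then show ?thesis
      using 3 by (simp add: norm_phi f_even_entry_eq)
  qed
qed

text \<open>From \<open>n = 2\<close> on this is one reduced equation times a squared norm;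
  \<open>n = 1\<close> combines \<open>D_tbar_2\<close> and \<open>D_gbar_2\<close>.\<close>

lemma odd_row:
  assumes y: "y \<in> S" and n: "1 \<le> n" "n \<le> m_odd M"
  shows "(\<Sum>m=Suc 0..m_even M. coupling m n * D (f_even_entry f m) y)
    = - (1 / Kn) * (ip_\<omega> (varphi n) (varphi n) * f_odd_entry f n y)"
proof -
  note bounds = m_even_m_odd[OF M]
  have n_le: "n \<le> m_even M"
    using n(2) bounds(2) by simp
  have "n = Suc 0 \<or> even n \<and> 2 \<le> n \<or> odd n \<and> 3 \<le> n"
    using n by presburger
  then consider "n = Suc 0" | "even n" "2 \<le> n" | "odd n" "3 \<le> n"
    by blast
  then show ?thesis
  proof cases
    case 1
    let ?\<delta> = "1 - of_bool (M = 3) :: real"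
    have entries: "f_even_entry f 2 = tbar f 2" "f_even_entry f 3 = gbar f 2"
      using f_even_entry_eq(2)[of 2] f_even_entry_eq(3)[of 3] by simp_all
    have pre: "Suc 0 \<le> m_even M" "m_even M \<noteq> 2"
      using bounds(1,2) unfolding m_even_def by presburger+
    have "(\<Sum>m=Suc 0..m_even M. coupling m n * D (f_even_entry f m) y)
      = 9 * D (tbar f 0) y + ?\<delta> * (24 * D (tbar f 2) y - 6 * D (gbar f 2) y)"
      unfolding 1 coupling_column_sum_1[OF pre] bounds(4) f_even_entry_eq(1) entries
      by (cases "M = 3") simp_all
    \<comment> \<open>The weights 6 and -3 cancel both the derivative of \<theta> and the terms with
      \<open>1 - Pr\<close>.\<close>
    also have "\<dots> = 6 * (D (tbar f 0) y + 1 / 2 * D \<theta> y + ?\<delta> * (4 * D (tbar f 2) y))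
        - 3 * (- D (tbar f 0) y + D \<theta> y + ?\<delta> * (2 * D (gbar f 2) y))"
      by (simp add: algebra_simps)
    also have "\<dots> = - (1 / Kn) * (6 * tbar f 1 y - 3 * gbar f 1 y)"
      unfolding D_tbar_2[OF y] D_gbar_2[OF y] by (simp add: algebra_simps diff_divide_distrib)
    \<comment> \<open>This is where the shift by a fifth of the heat flux in the first odd unknown
      comes from.\<close>
    also have "6 * tbar f 1 y - 3 * gbar f 1 y = 15 * f_odd_entry f n y"
      unfolding 1 f_odd_entry_eq qbar_eq by (simp add: algebra_simps)
    finally show ?thesis
      by (simp add: norm_varphi 1)
  next
    case 2
    have diag: "coupling n n = fact (n + 3)"
      using 2 by (simp add: coupling_ge_2)
    have n2: "even (n + 2)" "2 \<le> n + 2"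
      using 2 by simp_all
    have sub: "coupling (n + 2) n = real (n + 4) * fact (n + 3)"
      using coupling_ge_2[OF n2(2) 2(2)] 2 fact_reduce[of "n + 4", where 'a = real]
      by (simp add: add.commute)
    have last: "n + 2 \<le> m_even M \<longleftrightarrow> \<not> n + 3 = M"
      using 2 n bounds(7)[of n] bounds(5)[OF n2(1)] by auto
    have le: "n + 3 \<le> M"
      using 2 n bounds(7)[of n] by simp
    have pos: "1 \<le> n"
      using 2 by simp
    have "(\<Sum>m=Suc 0..m_even M. coupling m n * D (f_even_entry f m) y)
       = fact (n + 3) * (- (1 / Kn) * tbar f (n + 1) y)"
      unfolding coupling_column_sum[OF 2(2) n_le] diag sub last f_even_entry_eq(2)[OF 2(1)]
        f_even_entry_eq(2)[OF n2(1)] factor_if D_tbar[OF y pos le] ..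
    then show ?thesis
      using 2 by (simp add: norm_varphi f_odd_entry_eq)
  next
    case 3
    have n_ge: "2 \<le> n"
      using 3 by simp
    have diag: "coupling n n = fact n"
      using 3 by (simp add: coupling_ge_2)
    have n2: "odd (n + 2)" "2 \<le> n + 2" "n \<noteq> Suc 0" "n + 2 \<noteq> Suc 0" "n + 2 - 1 = n + 1"
      using 3 by simp_all
    have sub: "coupling (n + 2) n = real (n + 1) * fact n"
      using coupling_ge_2[OF n2(2) n_ge] 3 by simp
    have last: "n + 2 \<le> m_even M \<longleftrightarrow> \<not> n + 2 = M"
      using 3 n bounds(8)[of n] bounds(6)[OF n2(1)] by auto
    have arith: "n - 1 + 3 = n + 2" "n - 1 + 2 = n + 1" "n - 1 + 1 = n"
      using 3 by auto
    have prems: "1 \<le> n - 1" "n - 1 + 3 \<le> M"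
      using 3 n bounds(8)[of n] by auto
    have "(\<Sum>m=Suc 0..m_even M. coupling m n * D (f_even_entry f m) y)
       = fact n * (- (1 / Kn) * gbar f n y)"
      unfolding coupling_column_sum[OF n_ge n_le] diag sub last f_even_entry_eq(3)[OF 3(1) n2(3)]
        f_even_entry_eq(3)[OF n2(1,4)] n2(5) factor_if D_gbar_ge_2[OF y prems, unfolded arith] ..
    then show ?thesis
      using 3 by (simp add: norm_varphi f_odd_entry_eq)
  qed
qed

section \<open>Normalisation and the block system\<close>

lemma w_even_eq: "w_even M f y = Matrix.vec (m_even M) (\<lambda>i. a_coef (Suc i) * f_even_entry f (Suc i) y)"
  by (rule eq_vecI) (auto simp: w_even_def L1_def f_even_def mat_diag_def scalar_prod_def
      if_distrib[of "\<lambda>t. t * _"] sum.delta cong: if_cong)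

lemma w_odd_eq: "w_odd M f y = Matrix.vec (m_odd M) (\<lambda>j. b_coef (Suc j) * f_odd_entry f (Suc j) y)"
  by (rule eq_vecI) (auto simp: w_odd_def L2_def f_odd_def mat_diag_def scalar_prod_def
      if_distrib[of "\<lambda>t. t * _"] sum.delta cong: if_cong)

lemma ddy_vec_w_hat:
  assumes y: "y \<in> S"
  shows "ddy_vec S (w_hat M f) y
    = Matrix.vec (m_even M) (\<lambda>i. a_coef (Suc i) * D (f_even_entry f (Suc i)) y)
      @\<^sub>v Matrix.vec (m_odd M) (\<lambda>j. b_coef (Suc j) * D (f_odd_entry f (Suc j)) y)"
  by (rule eq_vecI)
    (auto simp: ddy_vec_def w_hat_def w_even_eq w_odd_eq index_append_vec
      intro!: ddy_cmult diff_f_even_entry diff_f_odd_entry y)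

text \<open>\<open>M0\<close> divides \<open>coupling\<close> by two norms. One cancels against the
  scaling of the differentiated vector; the other reduces the squared norm from
  \<open>even_row\<close> or \<open>odd_row\<close> to the scaling in \<open>w_hat\<close>.\<close>

lemma w_hat_equation:
  assumes y: "y \<in> S"
  shows "block_matrix M *\<^sub>v ddy_vec S (w_hat M f) y = - (1 / Kn) \<cdot>\<^sub>v w_hat M f y"
proof -
  let ?De = "Matrix.vec (m_even M) (\<lambda>i. a_coef (Suc i) * D (f_even_entry f (Suc i)) y)"
  let ?Do = "Matrix.vec (m_odd M) (\<lambda>j. b_coef (Suc j) * D (f_odd_entry f (Suc j)) y)"
  have even: "M0 M *\<^sub>v ?Do = - (1 / Kn) \<cdot>\<^sub>v w_even M f y"
  proof (rule eq_vecI)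
    fix i assume "i < dim_vec (- (1 / Kn) \<cdot>\<^sub>v w_even M f y)"
    then have i: "i < m_even M" by (simp add: w_even_eq)
    have "vec_index (M0 M *\<^sub>v ?Do) i
        = (\<Sum>j<m_odd M. m0_entry (Suc i) (Suc j) * (b_coef (Suc j) * D (f_odd_entry f (Suc j)) y))"
      using i by (simp add: M0_def scalar_prod_def lessThan_atLeast0)
    also have "\<dots> = 1 / a_coef (Suc i) * (\<Sum>j<m_odd M. coupling (Suc i) (Suc j) * D (f_odd_entry f (Suc j)) y)"
      using b_coef_pos
      by (auto simp: m0_entry_def coupling_def sum_distrib_left less_imp_neq[symmetric] intro!: sum.cong)
    also have "(\<Sum>j<m_odd M. coupling (Suc i) (Suc j) * D (f_odd_entry f (Suc j)) y)
        = - (1 / Kn) * (a_coef (Suc i) * a_coef (Suc i) * f_even_entry f (Suc i) y)"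
      unfolding a_coef_square using even_row[OF y, of "Suc i"] i by (simp add: sum.atLeast1_atMost_eq)
    finally show "vec_index (M0 M *\<^sub>v ?Do) i = vec_index (- (1 / Kn) \<cdot>\<^sub>v w_even M f y) i"
      using i a_coef_pos[of "Suc i"] by (simp add: w_even_eq)
  qed (simp add: M0_def w_even_eq)
  have odd: "transpose_mat (M0 M) *\<^sub>v ?De = - (1 / Kn) \<cdot>\<^sub>v w_odd M f y"
  proof (rule eq_vecI)
    fix j assume "j < dim_vec (- (1 / Kn) \<cdot>\<^sub>v w_odd M f y)"
    then have j: "j < m_odd M" by (simp add: w_odd_eq)
    have "vec_index (transpose_mat (M0 M) *\<^sub>v ?De) j
        = (\<Sum>i<m_even M. m0_entry (Suc i) (Suc j) * (a_coef (Suc i) * D (f_even_entry f (Suc i)) y))"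
      using j by (simp add: M0_def scalar_prod_def lessThan_atLeast0)
    also have "\<dots> = 1 / b_coef (Suc j) * (\<Sum>i<m_even M. coupling (Suc i) (Suc j) * D (f_even_entry f (Suc i)) y)"
      using a_coef_pos
      by (auto simp: m0_entry_def coupling_def sum_distrib_left less_imp_neq[symmetric] intro!: sum.cong)
    also have "(\<Sum>i<m_even M. coupling (Suc i) (Suc j) * D (f_even_entry f (Suc i)) y)
        = - (1 / Kn) * (b_coef (Suc j) * b_coef (Suc j) * f_odd_entry f (Suc j) y)"
      unfolding b_coef_square using odd_row[OF y, of "Suc j"] j by (simp add: sum.atLeast1_atMost_eq)
    finally show "vec_index (transpose_mat (M0 M) *\<^sub>v ?De) j = vec_index (- (1 / Kn) \<cdot>\<^sub>v w_odd M f y) j"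
      using j b_coef_pos[of "Suc j"] by (simp add: w_odd_eq)
  qed (simp add: M0_def w_odd_eq)
  have dims: "?De \<in> carrier_vec (m_even M)" "?Do \<in> carrier_vec (m_odd M)"
    "M0 M \<in> carrier_mat (m_even M) (m_odd M)" "transpose_mat (M0 M) \<in> carrier_mat (m_odd M) (m_even M)"
    by (simp_all add: M0_def)
  have "block_matrix M *\<^sub>v (?De @\<^sub>v ?Do)
      = (0\<^sub>m (m_even M) (m_even M) *\<^sub>v ?De + M0 M *\<^sub>v ?Do)
        @\<^sub>v (transpose_mat (M0 M) *\<^sub>v ?De + 0\<^sub>m (m_odd M) (m_odd M) *\<^sub>v ?Do)"
    unfolding block_matrix_def
    by (rule four_block_mat_mult_vec) (use dims in auto)
  also have "\<dots> = - (1 / Kn) \<cdot>\<^sub>v w_hat M f y"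
    unfolding even odd w_hat_def by (rule eq_vecI) (auto simp: w_even_eq w_odd_eq)
  finally show ?thesis
    unfolding ddy_vec_w_hat[OF y] .
qed

end

theorem theorem3p1:
  fixes M :: nat and Kn Pr :: real and S :: "real set"
    and f :: "nat^3 \<Rightarrow> real \<Rightarrow> real" and \<theta> :: "real \<Rightarrow> real" and u :: "3 \<Rightarrow> real \<Rightarrow> real"
  assumes "M \<ge> 3" and "Kn > 0" and "Pr > 0"
    and "is_interval S" and "interior S \<noteq> {}"
    and "moment_solution M Kn Pr S f \<theta> u"
  shows "\<forall>y\<in>S.
     qbar f 2 y = 3 * tbar f 1 y + gbar f 1 y \<and>
     ddy S (qbar f 2) y = 0 \<and>
     ddy S \<theta> y = - (2/5) * (1 / Kn) * Pr * qbar f 2 y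
       - 4/5 * ddy S (\<lambda>z. tbar f 0 z + (1 - of_bool (M = 3)) * (6 * tbar f 2 z + gbar f 2 z)) y \<and>
     block_matrix M *\<^sub>v ddy_vec S (w_hat M f) y = - (1 / Kn) \<cdot>\<^sub>v w_hat M f y"
proof -
  interpret moment_system S M Kn Pr f \<theta> u
    by unfold_locales (use assms in auto)
  show ?thesis
    using qbar_eq D_qbar D_\<theta> w_hat_equation by blast
qed

end
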